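(* Suppose that $A$ is an Arens regular Banach algebra with a bounded approximate identity. Then: (i) $A^*$ factors on both sides. (ii) $A^{**}$ is unital, and if $A$ is weakly sequentially complete then $A$ is also unital.
   Context: $A$ is regarded as a subspace of $A^{**}$. A bounded approximate identity is a bounded net $(e_\alpha)$ in $A$ with $ae_\alpha\to a$ and $e_\alpha a\to a$ in norm for each $a\in A$. For $a,b\in A$, $f\in A^*$, $F,G\in A^{**}$, the first Arens product is defined by $\langle f.a,b\rangle=\langle f,ab\rangle$, $\langle F.f,a\rangle=\langle F,f.a\rangle$, $\langle F.G,f\rangle=\langle F,G.f\rangle$; the second by $\langle a\circ f,b\rangle=\langle f,ba\rangle$, $\langle f\circ F,a\rangle=\langle F,a\circ f\rangle$, $\langle F\circ G,f\rangle=\langle G,f\circ F\rangle$. $A$ is Arens regular if $F.G=F\circ G$ for all $F,G\in A^{**}$. $A^{**}$ is considered as an algebra with the first Arens product; unital means having a two-sided unit element. $A^*$ factors on both sides if $A^*A=AA^*=A^*$, where $A^*A=\{f.a: f\in A^*,a\in A\}$ and $AA^*=\{a\circ f: a\in A,f\in A^*\}$. $A$ is weakly sequentially complete if every weakly Cauchy sequence in $A$ has a weak limit. *)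

theory Defs
  imports "HOL-Analysis.Analysis"
begin

(* The scalar field is \<real> or \<complex>. Besides the field structure the class fixes the norm,
   which is multiplicative and extends the absolute value of \<real>, hence is the usual modulus. *)
class real_or_complex = real_normed_field +
  assumes real_or_complex:
    "(\<forall>z. \<exists>x. z = x *\<^sub>R 1) \<or> (\<exists>i. i * i = -1 \<and> (\<forall>z. \<exists>x y. z = x *\<^sub>R 1 + y *\<^sub>R i))"

instance real :: real_or_complex
  by standard auto

instance complex :: real_or_complex
proof
  have "z = Re z *\<^sub>R 1 + Im z *\<^sub>R \<i>" for z
    by (simp add: complex_eq_iff)
  moreover have "\<i> * \<i> = -1"
    by simp
  ultimately show "(\<forall>z::complex. \<exists>x. z = x *\<^sub>R 1) \<or>
      (\<exists>i::complex. i * i = -1 \<and> (\<forall>z. \<exists>x y. z = x *\<^sub>R 1 + y *\<^sub>R i))"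
    by blast
qed

(* The type class supplies completeness, the submultiplicative norm and the underlying real
   algebra; smul is the scalar multiplication over the actual scalar field. No unit is assumed. *)
locale banach_algebra = vector_space smul
  for smul :: "'k::real_or_complex \<Rightarrow> 'a::{real_normed_algebra,banach} \<Rightarrow> 'a" +
  assumes smul_of_real: "smul (of_real r) a = r *\<^sub>R a"
    and norm_smul: "norm (smul c a) = norm c * norm a"
    and smul_mult_left: "smul c a * b = smul c (a * b)"
    and smul_mult_right: "a * smul c b = smul c (a * b)"

definition dual :: "('k::real_or_complex \<Rightarrow> 'a::{real_normed_algebra,banach} \<Rightarrow> 'a) \<Rightarrow> ('a \<Rightarrow> 'k) set"
  where "dual smul =
    {f. Vector_Spaces.linear smul (*) f \<and> (\<exists>K. \<forall>a. norm (f a) \<le> K * norm a)}"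

(* The dual is a set, not a type, so elements of the bidual are made extensional: their equality
   as functions is then equality on the dual. The norm of the dual is the operator norm onorm. *)
definition bidual ::
    "('k::real_or_complex \<Rightarrow> 'a::{real_normed_algebra,banach} \<Rightarrow> 'a) \<Rightarrow> (('a \<Rightarrow> 'k) \<Rightarrow> 'k) set"
  where "bidual smul =
    {F \<in> extensional (dual smul).
      (\<forall>f\<in>dual smul. \<forall>g\<in>dual smul. F (\<lambda>a. f a + g a) = F f + F g) \<and>
      (\<forall>c. \<forall>f\<in>dual smul. F (\<lambda>a. c * f a) = c * F f) \<and>
      (\<exists>K. \<forall>f\<in>dual smul. norm (F f) \<le> K * onorm f)}"

(* f.a, F.f and F.G *)
definition dual_act1 :: "('a::times \<Rightarrow> 'k) \<Rightarrow> 'a \<Rightarrow> ('a \<Rightarrow> 'k)"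
  where "dual_act1 f a = (\<lambda>b. f (a * b))"

definition bidual_act1 :: "(('a::times \<Rightarrow> 'k) \<Rightarrow> 'k) \<Rightarrow> ('a \<Rightarrow> 'k) \<Rightarrow> ('a \<Rightarrow> 'k)"
  where "bidual_act1 F f = (\<lambda>a. F (dual_act1 f a))"

definition arens1 :: "('k::real_or_complex \<Rightarrow> 'a::{real_normed_algebra,banach} \<Rightarrow> 'a) \<Rightarrow>
    (('a \<Rightarrow> 'k) \<Rightarrow> 'k) \<Rightarrow> (('a \<Rightarrow> 'k) \<Rightarrow> 'k) \<Rightarrow> (('a \<Rightarrow> 'k) \<Rightarrow> 'k)"
  where "arens1 smul F G = (\<lambda>f\<in>dual smul. F (bidual_act1 G f))"

(* a \<circ> f, f \<circ> F and F \<circ> G *)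
definition dual_act2 :: "'a::times \<Rightarrow> ('a \<Rightarrow> 'k) \<Rightarrow> ('a \<Rightarrow> 'k)"
  where "dual_act2 a f = (\<lambda>b. f (b * a))"

definition bidual_act2 :: "('a::times \<Rightarrow> 'k) \<Rightarrow> (('a \<Rightarrow> 'k) \<Rightarrow> 'k) \<Rightarrow> ('a \<Rightarrow> 'k)"
  where "bidual_act2 f F = (\<lambda>a. F (dual_act2 a f))"

definition arens2 :: "('k::real_or_complex \<Rightarrow> 'a::{real_normed_algebra,banach} \<Rightarrow> 'a) \<Rightarrow>
    (('a \<Rightarrow> 'k) \<Rightarrow> 'k) \<Rightarrow> (('a \<Rightarrow> 'k) \<Rightarrow> 'k) \<Rightarrow> (('a \<Rightarrow> 'k) \<Rightarrow> 'k)"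
  where "arens2 smul F G = (\<lambda>f\<in>dual smul. G (bidual_act2 f F))"

definition arens_regular :: "('k::real_or_complex \<Rightarrow> 'a::{real_normed_algebra,banach} \<Rightarrow> 'a) \<Rightarrow> bool"
  where "arens_regular smul \<longleftrightarrow>
    (\<forall>F\<in>bidual smul. \<forall>G\<in>bidual smul. arens1 smul F G = arens2 smul F G)"

definition directed :: "'i set \<Rightarrow> ('i \<Rightarrow> 'i \<Rightarrow> bool) \<Rightarrow> bool"
  where "directed I le \<longleftrightarrow> I \<noteq> {} \<and>
    (\<forall>i\<in>I. le i i) \<and>
    (\<forall>i\<in>I. \<forall>j\<in>I. \<forall>k\<in>I. le i j \<longrightarrow> le j k \<longrightarrow> le i k) \<and>
    (\<forall>i\<in>I. \<forall>j\<in>I. \<exists>k\<in>I. le i k \<and> le j k)"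

(* The filter of tails: convergence of a net indexed by I is convergence along this filter. *)
definition tails :: "'i set \<Rightarrow> ('i \<Rightarrow> 'i \<Rightarrow> bool) \<Rightarrow> 'i filter"
  where "tails I le = (INF i\<in>I. principal {j\<in>I. le i j})"

definition bounded_approximate_identity ::
    "'i set \<Rightarrow> ('i \<Rightarrow> 'i \<Rightarrow> bool) \<Rightarrow> ('i \<Rightarrow> 'a::real_normed_algebra) \<Rightarrow> bool"
  where "bounded_approximate_identity I le e \<longleftrightarrow> directed I le \<and> bounded (e ` I) \<and>
    (\<forall>a. ((\<lambda>i. a * e i) \<longlongrightarrow> a) (tails I le) \<and> ((\<lambda>i. e i * a) \<longlongrightarrow> a) (tails I le))"

definition factors_on_both_sides ::
    "('k::real_or_complex \<Rightarrow> 'a::{real_normed_algebra,banach} \<Rightarrow> 'a) \<Rightarrow> bool"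
  where "factors_on_both_sides smul \<longleftrightarrow>
    {dual_act1 f a |f a. f \<in> dual smul} = dual smul \<and>
    {dual_act2 a f |a f. f \<in> dual smul} = dual smul"

definition has_unit :: "'b set \<Rightarrow> ('b \<Rightarrow> 'b \<Rightarrow> 'b) \<Rightarrow> bool"
  where "has_unit S m \<longleftrightarrow> (\<exists>u\<in>S. \<forall>x\<in>S. m u x = x \<and> m x u = x)"

definition weakly_sequentially_complete ::
    "('k::real_or_complex \<Rightarrow> 'a::{real_normed_algebra,banach} \<Rightarrow> 'a) \<Rightarrow> bool"
  where "weakly_sequentially_complete smul \<longleftrightarrow>
    (\<forall>x :: nat \<Rightarrow> 'a. (\<forall>f\<in>dual smul. Cauchy (\<lambda>n. f (x n))) \<longrightarrow>
      (\<exists>l. \<forall>f\<in>dual smul. (\<lambda>n. f (x n)) \<longlonglongrightarrow> f l))"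

end

theory Submission
  imports Defs
begin

text \<open>
  Hahn-Banach provides functionals \<open>E\<close> on the dual that extend the limit along a given bounded net
  or sequence. For the approximate identity, \<open>E.f = f = f \<circ> E\<close>, so \<open>G.E = G\<close> and \<open>E \<circ> G = G\<close>, and
  regularity makes \<open>E\<close> a two-sided unit. If \<open>F\<close> vanishes on all \<open>f.a\<close>, then \<open>F.f = 0\<close> and
  \<open>\<langle>F, f\<rangle> = \<langle>E.F, f\<rangle> = 0\<close>; hence \<open>f.e\<^sub>i \<rightarrow> f\<close> in norm by Hahn-Banach, and Cohen's theorem factors \<open>f\<close>.

  If a bounded sequence satisfies \<open>x\<^sub>m x\<^sub>n \<rightarrow> x\<^sub>m\<close> and \<open>x\<^sub>n x\<^sub>m \<rightarrow> x\<^sub>m\<close> for all \<open>m\<close>, then any two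
  generalized limits \<open>F, G\<close> along it satisfy \<open>F.G = F\<close> and \<open>F \<circ> G = G\<close> on the functionals in
  question, so they agree and the sequence is weakly Cauchy. In the weakly sequentially complete case,
  the weak limit of such a sequence chosen from the net is an idempotent acting as a unit on any
  prescribed finite set. If \<open>A\<close> had no unit, this would give a bounded strictly increasing sequence of
  idempotents \<open>p\<^sub>n\<close>. Its weak limit lies in the closed subspace of all \<open>z\<close> with \<open>p\<^sub>n z \<rightarrow> z\<close>, so \<open>p\<^sub>n\<close> would
  converge in norm, although \<open>p\<^sub>n\<^sub>+\<^sub>1 - p\<^sub>n\<close> is a nonzero idempotent and so has norm at least \<open>1\<close>.
\<close>

subsection \<open>Sublinear functionals and the Hahn-Banach theorem\<close>

definition sublinear :: "('v::real_vector \<Rightarrow> real) \<Rightarrow> bool"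
  where "sublinear p \<longleftrightarrow>
    (\<forall>x y. p (x + y) \<le> p x + p y) \<and> (\<forall>r\<ge>0. \<forall>x. p (r *\<^sub>R x) = r * p x)"

text \<open>Applying \<open>scale\<close> with \<open>1 / r\<close> gives the reverse inequality, so
  one direction of homogeneity is enough.\<close>

lemma sublinearI:
  assumes add: "\<And>x y. p (x + y) \<le> p x + p y"
    and zero: "p 0 = 0"
    and scale: "\<And>r x. r > 0 \<Longrightarrow> p (r *\<^sub>R x) \<le> r * p x"
  shows "sublinear p"
proof -
  have "p (r *\<^sub>R x) = r * p x" if "r \<ge> 0" for r x
  proof (cases "r = 0")
    case False
    with that have r: "r > 0" by simp
    have "p ((1 / r) *\<^sub>R (r *\<^sub>R x)) \<le> (1 / r) * p (r *\<^sub>R x)"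
      by (rule scale) (use r in simp)
    then have "r * p x \<le> p (r *\<^sub>R x)"
      using r by (simp add: field_simps)
    with scale[OF r, of x] show ?thesis by linarith
  qed (simp add: zero)
  with add show ?thesis by (auto simp: sublinear_def)
qed

lemma sublinear_add: "sublinear p \<Longrightarrow> p (x + y) \<le> p x + p y"
  and sublinear_scale: "sublinear p \<Longrightarrow> r \<ge> 0 \<Longrightarrow> p (r *\<^sub>R x) = r * p x"
  by (auto simp: sublinear_def)

lemma sublinear_zero: "sublinear p \<Longrightarrow> p 0 = 0"
  using sublinear_scale[of p 0 0] by simp

lemma sublinear_minus: "sublinear p \<Longrightarrow> - p (- x) \<le> p x"
  using sublinear_add[of p x "- x"] sublinear_zero[of p] by simp

lemma sublinear_odd_imp_linear:
  assumes q: "sublinear q" and odd: "\<And>x. q (- x) = - q x"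
  shows "linear q"
proof
  fix x y :: 'a and r :: real
  show "q (x + y) = q x + q y"
    using sublinear_add[OF q, of x y] sublinear_add[OF q, of "- x" "- y"] odd[of "x + y"]
    by (simp add: odd)
  show "q (r *\<^sub>R x) = r *\<^sub>R q x"
  proof (cases "r \<ge> 0")
    case False
    then have "q ((- r) *\<^sub>R x) = (- r) * q x"
      by (intro sublinear_scale[OF q]) auto
    with odd[of "r *\<^sub>R x"] show ?thesis by simp
  qed (simp add: sublinear_scale[OF q])
qed

text \<open>The largest sublinear functional below \<open>q\<close> that is linear along the line through \<open>x\<close> and agrees with \<open>q\<close> at \<open>x\<close>.\<close>

definition linearize_along :: "('v::real_vector \<Rightarrow> real) \<Rightarrow> 'v \<Rightarrow> 'v \<Rightarrow> real"
  where "linearize_along q x z = (INF t\<in>{0..}. q (z + t *\<^sub>R x) - t * q x)"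

lemma linearize_along_le:
  assumes q: "sublinear q" and t: "t \<ge> 0"
  shows "linearize_along q x z \<le> q (z + t *\<^sub>R x) - t * q x"
  unfolding linearize_along_def
proof (rule cINF_lower)
  \<comment> \<open>Splitting \<open>t *\<^sub>R x\<close> as
    \<open>(z + t *\<^sub>R x) + (- z)\<close> bounds every term below by a quantity free of
    \<open>t\<close>, so the infimum is a genuine one.\<close>
  have "- q (- z) \<le> q (z + t *\<^sub>R x) - t * q x" if "t \<ge> 0" for t
    using sublinear_add[OF q, of "z + t *\<^sub>R x" "- z"] sublinear_scale[OF q that, of x] by simp
  then show "bdd_below ((\<lambda>t. q (z + t *\<^sub>R x) - t * q x) ` {0..})"
    by (intro bdd_belowI2) auto
qed (use t in simp)

lemma linearize_along_greatest:
  assumes "\<And>t. t \<ge> 0 \<Longrightarrow> c \<le> q (z + t *\<^sub>R x) - t * q x"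
  shows "c \<le> linearize_along q x z"
  unfolding linearize_along_def by (rule cINF_greatest) (use assms in auto)

lemma sublinear_linearize_along:
  assumes q: "sublinear q"
  shows "sublinear (linearize_along q x)"
proof (rule sublinearI)
  fix z w :: 'a
  let ?L = "linearize_along q x"
  \<comment> \<open>Parameters \<open>s\<close> for \<open>z\<close> and \<open>t\<close> for
    \<open>w\<close> combine into \<open>s + t\<close> for the sum; the infima over \<open>s\<close>
    and \<open>t\<close> are then taken one after the other.\<close>
  have le: "?L (z + w) \<le> (q (z + s *\<^sub>R x) - s * q x) + (q (w + t *\<^sub>R x) - t * q x)"
    if "s \<ge> 0" "t \<ge> 0" for s t
    using linearize_along_le[OF q, of "s + t" x "z + w"] that
      sublinear_add[OF q, of "z + s *\<^sub>R x" "w + t *\<^sub>R x"] by (simp add: algebra_simps)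
  have "?L (z + w) - ?L w \<le> q (z + s *\<^sub>R x) - s * q x" if "s \<ge> 0" for s
  proof -
    have "?L (z + w) - (q (z + s *\<^sub>R x) - s * q x) \<le> ?L w"
      by (rule linearize_along_greatest) (use le[OF that] in \<open>simp add: algebra_simps\<close>)
    then show ?thesis by simp
  qed
  then have "?L (z + w) - ?L w \<le> ?L z"
    by (rule linearize_along_greatest)
  then show "?L (z + w) \<le> ?L z + ?L w" by simp
next
  show "linearize_along q x 0 = 0"
    by (simp add: linearize_along_def sublinear_scale[OF q])
next
  fix r :: real and z
  assume r: "r > 0"
  have "linearize_along q x (r *\<^sub>R z) / r \<le> q (z + t *\<^sub>R x) - t * q x" if "t \<ge> 0" for t
  proof -
    have "linearize_along q x (r *\<^sub>R z) \<le> q (r *\<^sub>R z + (r * t) *\<^sub>R x) - r * t * q x"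
      by (rule linearize_along_le[OF q]) (use r that in simp)
    also have "r *\<^sub>R z + (r * t) *\<^sub>R x = r *\<^sub>R (z + t *\<^sub>R x)"
      by (simp add: algebra_simps)
    also have "q \<dots> = r * q (z + t *\<^sub>R x)"
      by (rule sublinear_scale[OF q]) (use r in simp)
    finally show ?thesis using r by (simp add: field_simps)
  qed
  then have "linearize_along q x (r *\<^sub>R z) / r \<le> linearize_along q x z"
    by (rule linearize_along_greatest)
  then show "linearize_along q x (r *\<^sub>R z) \<le> r * linearize_along q x z"
    using r by (simp add: field_simps)
qed

lemma linearize_along_below: "sublinear q \<Longrightarrow> linearize_along q x z \<le> q z"
  using linearize_along_le[of q 0 x z] by simp

text \<open>At \<open>t = 1\<close> the term is \<open>q 0 - q x\<close>. This inequality forces a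
  minimal sublinear functional to be odd.\<close>

lemma linearize_along_minus: "sublinear q \<Longrightarrow> linearize_along q x (- x) \<le> - q x"
  using linearize_along_le[of q 1 x "- x"] by (simp add: sublinear_zero)

lemma sublinear_INF_chain:
  assumes C: "C \<noteq> {}" "\<And>q. q \<in> C \<Longrightarrow> sublinear q \<and> (\<forall>x. q x \<le> p x)"
    and chain: "\<And>q r. q \<in> C \<Longrightarrow> r \<in> C \<Longrightarrow> q \<le> r \<or> r \<le> q"
  defines "m \<equiv> \<lambda>x. INF q\<in>C. q x"
  shows "sublinear m" and "\<And>q x. q \<in> C \<Longrightarrow> m x \<le> q x"
proof -
  show le: "m x \<le> q x" if "q \<in> C" for q x
    unfolding m_def
  proof (rule cINF_lower)
    have "- p (- x) \<le> q x" if "q \<in> C" for q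
      using C(2)[OF that] sublinear_minus[of q x] by (meson neg_le_iff_le order_trans)
    then show "bdd_below ((\<lambda>q. q x) ` C)" by (rule bdd_belowI2)
  qed fact
  have greatest: "c \<le> m x" if "\<And>q. q \<in> C \<Longrightarrow> c \<le> q x" for c x
    unfolding m_def by (rule cINF_greatest[OF C(1)]) (rule that)
  show "sublinear m"
  proof (rule sublinearI)
    fix x y
    \<comment> \<open>Members of the chain are comparable, and the smaller one serves for both
      \<open>x\<close> and \<open>y\<close>.\<close>
    have pair: "m (x + y) \<le> q x + r y" if "q \<in> C" "r \<in> C" for q r
      using chain[OF that]
    proof
      assume "q \<le> r"
      then have "q y \<le> r y" by (simp add: le_fun_def)
      moreover have "q (x + y) \<le> q x + q y" using C(2) that by (simp add: sublinear_add)
      ultimately show ?thesis using le[OF that(1), of "x + y"] by linarith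
    next
      assume "r \<le> q"
      then have "r x \<le> q x" by (simp add: le_fun_def)
      moreover have "r (x + y) \<le> r x + r y" using C(2) that by (simp add: sublinear_add)
      ultimately show ?thesis using le[OF that(2), of "x + y"] by linarith
    qed
    have "m (x + y) - m y \<le> q x" if "q \<in> C" for q
    proof -
      have "m (x + y) - q x \<le> m y"
        by (rule greatest) (use pair[OF that] in \<open>simp add: algebra_simps\<close>)
      then show ?thesis by simp
    qed
    then have "m (x + y) - m y \<le> m x" by (rule greatest)
    then show "m (x + y) \<le> m x + m y" by simp
  next
    have "(\<lambda>q. q 0) ` C = {0}" using C by (auto simp: sublinear_zero image_iff)
    then show "m 0 = 0" by (simp add: m_def)
  next
    fix r :: real and x
    assume r: "r > 0"
    have "m (r *\<^sub>R x) / r \<le> q x" if "q \<in> C" for q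
      using le[OF that, of "r *\<^sub>R x"] C(2)[OF that] r by (simp add: sublinear_scale field_simps)
    then have "m (r *\<^sub>R x) / r \<le> m x" by (rule greatest)
    then show "m (r *\<^sub>R x) \<le> r * m x" using r by (simp add: field_simps)
  qed
qed

text \<open>Zorn's lemma gives a minimal sublinear \<open>q\<close> below \<open>p\<close>. Since
  \<open>linearize_along q x\<close> is sublinear and below \<open>q\<close>, it equals
  \<open>q\<close>, so \<open>q\<close> is odd and hence linear.\<close>

lemma ex_linear_below_sublinear:
  assumes p: "sublinear p"
  shows "\<exists>u. linear u \<and> (\<forall>x. u x \<le> p x)"
proof -
  let ?A = "{q. sublinear q \<and> (\<forall>x. q x \<le> p x)}"
  \<comment> \<open>The reversed order turns the maximal element of Zorn's lemma into a minimal
    functional.\<close>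
  let ?P = "\<lambda>a b :: 'a \<Rightarrow> real. b \<le> a"
  have "\<exists>m\<in>?A. \<forall>a\<in>?A. ?P m a \<longrightarrow> a = m"
  proof (rule predicate_Zorn)
    show "partial_order_on ?A (relation_of ?P ?A)"
      by (rule partial_order_on_relation_ofI) auto
  next
    fix C
    assume C: "C \<in> Chains (relation_of ?P ?A)"
    show "\<exists>u\<in>?A. \<forall>a\<in>C. ?P a u"
    proof (cases "C = {}")
      case True
      with p show ?thesis by auto
    next
      case False
      have CA: "\<And>q. q \<in> C \<Longrightarrow> sublinear q \<and> (\<forall>x. q x \<le> p x)"
        and ch: "\<And>q r. q \<in> C \<Longrightarrow> r \<in> C \<Longrightarrow> q \<le> r \<or> r \<le> q"
        using C by (auto simp: Chains_def relation_of_def)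
      note m = sublinear_INF_chain[OF False CA ch]
      show ?thesis
      proof (rule bexI[where x = "\<lambda>x. INF q\<in>C. q x"])
        show "\<forall>a\<in>C. (\<lambda>x. INF q\<in>C. q x) \<le> a"
          using m(2) by (auto simp: le_fun_def)
        obtain q where "q \<in> C" using False by auto
        with CA m(2) have "(INF q\<in>C. q x) \<le> p x" for x by (meson order_trans)
        with m(1) show "(\<lambda>x. INF q\<in>C. q x) \<in> ?A" by simp
      qed
    qed
  qed
  then obtain q where q: "sublinear q" "\<And>x. q x \<le> p x"
    and min: "\<And>r. sublinear r \<Longrightarrow> (\<And>x. r x \<le> p x) \<Longrightarrow> r \<le> q \<Longrightarrow> r = q"
    by auto
  have "q (- x) = - q x" for x
  proof -
    have "linearize_along q x = q"
      by (intro min sublinear_linearize_along q)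
        (auto intro: order_trans[OF linearize_along_below[OF q(1)] q(2)]
          linearize_along_below q simp: le_fun_def)
    with linearize_along_minus[OF q(1), of x] have "q (- x) \<le> - q x" by simp
    with sublinear_minus[OF q(1), of x] show ?thesis by simp
  qed
  then have "linear q" by (rule sublinear_odd_imp_linear[OF q(1)])
  with q(2) show ?thesis by auto
qed

text \<open>Starting from \<open>linearize_along p x0\<close> instead of \<open>p\<close> forces
  \<open>u (- x0) \<le> - p x0\<close>, which is the missing half of equality at
  \<open>x0\<close>.\<close>

theorem hahn_banach:
  assumes p: "sublinear p"
  obtains u where "linear u" "\<And>x. u x \<le> p x" "u x0 = p x0"
proof -
  from ex_linear_below_sublinear[OF sublinear_linearize_along[OF p, of x0]]
  obtain u where u: "linear u" and le: "\<And>x. u x \<le> linearize_along p x0 x" by blast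
  have "u x \<le> p x" for x
    by (rule order_trans[OF le linearize_along_below[OF p]])
  moreover have "p x0 \<le> u x0"
    using order_trans[OF le linearize_along_minus[OF p]] linear_neg[OF u] by fastforce
  ultimately show thesis using that u by (meson antisym)
qed

section \<open>Continuous functionals obtained from Hahn-Banach\<close>

lemma bounded_linear_below_sublinear:
  fixes u :: "'v::real_normed_vector \<Rightarrow> real"
  assumes u: "linear u" and le: "\<And>x. u x \<le> p x" and p: "\<And>x. p x \<le> C * norm x"
  shows "bounded_linear u"
proof -
  have "norm (u x) \<le> norm x * C" for x
  proof -
    have "u x \<le> norm x * C" using order_trans[OF le p, of x] by (simp add: mult.commute)
    moreover have "- u x \<le> norm x * C"
      using order_trans[OF le p, of "- x"] linear_neg[OF u, of x] by (simp add: mult.commute)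
    ultimately show ?thesis by (simp add: abs_le_iff)
  qed
  with u show ?thesis
    by (intro bounded_linear_intro[of _ C]) (simp_all add: linear_add linear_scale)
qed

lemma bounded_linear_norming:
  fixes x0 :: "'v::real_normed_vector"
  obtains u :: "'v \<Rightarrow> real" where "bounded_linear u" "\<And>x. u x \<le> norm x" "u x0 = norm x0"
proof -
  have "sublinear (norm :: 'v \<Rightarrow> real)"
    by (rule sublinearI) (auto intro: norm_triangle_ineq)
  then obtain u :: "'v \<Rightarrow> real" where u: "linear u" "\<And>x. u x \<le> norm x" "u x0 = norm x0"
    using hahn_banach by blast
  from bounded_linear_below_sublinear[OF u(1,2), of 1] u that show thesis by auto
qed

lemma eq_if_bounded_linear_eq:
  fixes x y :: "'v::real_normed_vector"
  assumes "\<And>u :: 'v \<Rightarrow> real. bounded_linear u \<Longrightarrow> u x = u y"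
  shows "x = y"
proof -
  obtain u :: "'v \<Rightarrow> real" where u: "bounded_linear u" "u (x - y) = norm (x - y)"
    using bounded_linear_norming[of "x - y"] by metis
  interpret bounded_linear u by fact
  from u(2) assms[OF u(1)] show ?thesis by (simp add: diff)
qed

subsection \<open>The upper limit of a bounded real function along a filter\<close>

text \<open>The infimum is one of reals and has its intended meaning only if the set is nonempty and
  bounded below; \<open>fbounded\<close> and a nontrivial filter ensure both.\<close>

definition flimsup :: "'i filter \<Rightarrow> ('i \<Rightarrow> real) \<Rightarrow> real"
  where "flimsup \<Phi> g = Inf {c. \<forall>\<^sub>F i in \<Phi>. g i \<le> c}"

definition fbounded :: "'i filter \<Rightarrow> ('i \<Rightarrow> real) \<Rightarrow> bool"
  where "fbounded \<Phi> g \<longleftrightarrow> (\<exists>K. \<forall>\<^sub>F i in \<Phi>. \<bar>g i\<bar> \<le> K)"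

lemma fboundedI: "(\<forall>\<^sub>F i in \<Phi>. \<bar>g i\<bar> \<le> K) \<Longrightarrow> fbounded \<Phi> g"
  by (auto simp: fbounded_def)

context
  fixes \<Phi> :: "'i filter"
  assumes nontrivial: "\<Phi> \<noteq> bot"
begin

lemma flimsup_le:
  assumes g: "fbounded \<Phi> g" and c: "\<forall>\<^sub>F i in \<Phi>. g i \<le> c"
  shows "flimsup \<Phi> g \<le> c"
  unfolding flimsup_def
proof (rule cInf_lower)
  obtain K where K: "\<forall>\<^sub>F i in \<Phi>. \<bar>g i\<bar> \<le> K" using g by (auto simp: fbounded_def)
  show "bdd_below {c. \<forall>\<^sub>F i in \<Phi>. g i \<le> c}"
  proof (rule bdd_belowI)
    fix c
    assume "c \<in> {c. \<forall>\<^sub>F i in \<Phi>. g i \<le> c}"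
    with K have "\<forall>\<^sub>F i in \<Phi>. - K \<le> c"
      by (auto elim: eventually_elim2)
    with nontrivial show "- K \<le> c" by simp
  qed
qed (use c in simp)

lemma flimsup_less:
  assumes g: "fbounded \<Phi> g" and c: "flimsup \<Phi> g < c"
  shows "\<forall>\<^sub>F i in \<Phi>. g i < c"
proof -
  obtain K where "\<forall>\<^sub>F i in \<Phi>. \<bar>g i\<bar> \<le> K" using g by (auto simp: fbounded_def)
  then have "\<forall>\<^sub>F i in \<Phi>. g i \<le> K" by (auto elim: eventually_mono)
  then have "{c. \<forall>\<^sub>F i in \<Phi>. g i \<le> c} \<noteq> {}" by auto
  from cInf_lessD[OF this c[unfolded flimsup_def]]
  obtain d where "\<forall>\<^sub>F i in \<Phi>. g i \<le> d" "d < c" by auto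
  then show ?thesis by (auto elim: eventually_mono)
qed

lemma fbounded_add: "fbounded \<Phi> g \<Longrightarrow> fbounded \<Phi> h \<Longrightarrow> fbounded \<Phi> (\<lambda>i. g i + h i)"
proof -
  assume "fbounded \<Phi> g" "fbounded \<Phi> h"
  then obtain K L where "\<forall>\<^sub>F i in \<Phi>. \<bar>g i\<bar> \<le> K" "\<forall>\<^sub>F i in \<Phi>. \<bar>h i\<bar> \<le> L"
    by (auto simp: fbounded_def)
  then have "\<forall>\<^sub>F i in \<Phi>. \<bar>g i + h i\<bar> \<le> K + L" by eventually_elim linarith
  then show ?thesis by (rule fboundedI)
qed

lemma fbounded_scale: "fbounded \<Phi> g \<Longrightarrow> fbounded \<Phi> (\<lambda>i. r * g i)"
proof -
  assume "fbounded \<Phi> g"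
  then obtain K where "\<forall>\<^sub>F i in \<Phi>. \<bar>g i\<bar> \<le> K" by (auto simp: fbounded_def)
  then have "\<forall>\<^sub>F i in \<Phi>. \<bar>r * g i\<bar> \<le> \<bar>r\<bar> * K"
    by eventually_elim (simp add: abs_mult mult_left_mono)
  then show ?thesis by (rule fboundedI)
qed

lemma flimsup_mono:
  assumes "fbounded \<Phi> g" "fbounded \<Phi> h" "\<forall>\<^sub>F i in \<Phi>. g i \<le> h i"
  shows "flimsup \<Phi> g \<le> flimsup \<Phi> h"
proof (rule field_le_epsilon)
  fix \<epsilon> :: real
  assume "\<epsilon> > 0"
  then have "\<forall>\<^sub>F i in \<Phi>. h i < flimsup \<Phi> h + \<epsilon>" by (intro flimsup_less assms) simp
  with assms(3) have "\<forall>\<^sub>F i in \<Phi>. g i \<le> flimsup \<Phi> h + \<epsilon>" by eventually_elim simp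
  then show "flimsup \<Phi> g \<le> flimsup \<Phi> h + \<epsilon>" by (rule flimsup_le[OF assms(1)])
qed

lemma flimsup_add:
  assumes "fbounded \<Phi> g" "fbounded \<Phi> h"
  shows "flimsup \<Phi> (\<lambda>i. g i + h i) \<le> flimsup \<Phi> g + flimsup \<Phi> h"
proof (rule field_le_epsilon)
  fix \<epsilon> :: real
  assume "\<epsilon> > 0"
  then have "\<forall>\<^sub>F i in \<Phi>. g i < flimsup \<Phi> g + \<epsilon> / 2" "\<forall>\<^sub>F i in \<Phi>. h i < flimsup \<Phi> h + \<epsilon> / 2"
    by (intro flimsup_less assms; simp)+
  then have "\<forall>\<^sub>F i in \<Phi>. g i + h i \<le> flimsup \<Phi> g + flimsup \<Phi> h + \<epsilon>"
    by eventually_elim simp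
  then show "flimsup \<Phi> (\<lambda>i. g i + h i) \<le> flimsup \<Phi> g + flimsup \<Phi> h + \<epsilon>"
    by (rule flimsup_le[OF fbounded_add[OF assms]])
qed

lemma flimsup_scale_le:
  assumes "fbounded \<Phi> g" "r > 0"
  shows "flimsup \<Phi> (\<lambda>i. r * g i) \<le> r * flimsup \<Phi> g"
proof (rule field_le_epsilon)
  fix \<epsilon> :: real
  assume "\<epsilon> > 0"
  then have "\<forall>\<^sub>F i in \<Phi>. g i < flimsup \<Phi> g + \<epsilon> / r"
    using assms by (intro flimsup_less) auto
  then have "\<forall>\<^sub>F i in \<Phi>. r * g i \<le> r * flimsup \<Phi> g + \<epsilon>"
    by eventually_elim (use assms(2) in \<open>simp add: field_simps\<close>)
  then show "flimsup \<Phi> (\<lambda>i. r * g i) \<le> r * flimsup \<Phi> g + \<epsilon>"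
    by (rule flimsup_le[OF fbounded_scale[OF assms(1)]])
qed

lemma fbounded_if_tendsto:
  assumes "(g \<longlongrightarrow> l) \<Phi>"
  shows "fbounded \<Phi> g"
proof -
  have "\<forall>\<^sub>F i in \<Phi>. dist (g i) l < 1" using tendstoD[OF assms] by simp
  then have "\<forall>\<^sub>F i in \<Phi>. \<bar>g i\<bar> \<le> \<bar>l\<bar> + 1" by eventually_elim (auto simp: dist_real_def)
  then show ?thesis by (rule fboundedI)
qed

lemma flimsup_eq_lim:
  assumes g: "(g \<longlongrightarrow> l) \<Phi>"
  shows "flimsup \<Phi> g = l"
proof -
  note b = fbounded_if_tendsto[OF g]
  have "flimsup \<Phi> g \<le> l"
  proof (rule field_le_epsilon)
    fix \<epsilon> :: real
    assume "\<epsilon> > 0"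
    then have "\<forall>\<^sub>F i in \<Phi>. g i < l + \<epsilon>" by (intro order_tendstoD[OF g]) simp
    then show "flimsup \<Phi> g \<le> l + \<epsilon>"
      by (intro flimsup_le[OF b]) (auto elim: eventually_mono)
  qed
  moreover have "l \<le> flimsup \<Phi> g"
  proof (rule ccontr)
    assume "\<not> l \<le> flimsup \<Phi> g"
    then obtain c where c: "flimsup \<Phi> g < c" "c < l" using dense by (meson not_le)
    from flimsup_less[OF b c(1)] order_tendstoD(1)[OF g c(2)]
    have "\<forall>\<^sub>F i in \<Phi>. False" by eventually_elim simp
    with nontrivial show False by simp
  qed
  ultimately show ?thesis by simp
qed

text \<open>The lower limit is \<open>- flimsup \<Phi> (\<lambda>i. - g i)\<close>, so the
  hypothesis puts the upper limit below the lower one.\<close>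

lemma tendsto_if_flimsup_minus:
  assumes g: "fbounded \<Phi> g" and le: "flimsup \<Phi> g + flimsup \<Phi> (\<lambda>i. - g i) \<le> 0"
  shows "(g \<longlongrightarrow> flimsup \<Phi> g) \<Phi>"
proof (rule order_tendstoI)
  fix a
  assume "a < flimsup \<Phi> g"
  with le have "flimsup \<Phi> (\<lambda>i. - g i) < - a" by linarith
  moreover have "fbounded \<Phi> (\<lambda>i. - g i)" using fbounded_scale[OF g, of "- 1"] by simp
  ultimately show "\<forall>\<^sub>F i in \<Phi>. a < g i" using flimsup_less by fastforce
qed (rule flimsup_less[OF g])

lemma sublinear_flimsup:
  assumes b: "\<And>x. fbounded \<Phi> (g x)"
    and add: "\<And>x y i. g (x + y) i \<le> g x i + g y i"
    and scale: "\<And>r x i. r \<ge> 0 \<Longrightarrow> g (r *\<^sub>R x) i = r * g x i"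
  shows "sublinear (\<lambda>x. flimsup \<Phi> (g x))"
proof (rule sublinearI)
  fix x y
  have "flimsup \<Phi> (g (x + y)) \<le> flimsup \<Phi> (\<lambda>i. g x i + g y i)"
    by (intro flimsup_mono fbounded_add b) (simp add: add)
  also have "\<dots> \<le> flimsup \<Phi> (g x) + flimsup \<Phi> (g y)"
    by (intro flimsup_add b)
  finally show "flimsup \<Phi> (g (x + y)) \<le> flimsup \<Phi> (g x) + flimsup \<Phi> (g y)" .
next
  have "g 0 i = 0" for i using scale[of 0 0 i] by simp
  then have "(g 0 \<longlongrightarrow> 0) \<Phi>" by (simp add: tendsto_eventually)
  then show "flimsup \<Phi> (g 0) = 0" by (rule flimsup_eq_lim)
next
  fix r :: real and x
  assume "r > 0"
  then have "g (r *\<^sub>R x) = (\<lambda>i. r * g x i)" by (simp add: scale fun_eq_iff)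
  with flimsup_scale_le[OF b \<open>r > 0\<close>] show "flimsup \<Phi> (g (r *\<^sub>R x)) \<le> r * flimsup \<Phi> (g x)"
    by simp
qed

text \<open>The upper limit of \<open>norm (T i x - x)\<close> is a sublinear gauge in
  \<open>x\<close>, bounded by \<open>(K + 1) * norm x\<close> and zero exactly where
  \<open>T i x\<close> tends to \<open>x\<close>. A functional below this gauge that attains it at
  \<open>x0\<close> has the desired properties.\<close>

lemma bounded_linear_separating_limits:
  fixes T :: "'i \<Rightarrow> 'v::real_normed_vector \<Rightarrow> 'v"
  assumes T: "\<And>i. linear (T i)" and K: "\<forall>\<^sub>F i in \<Phi>. \<forall>x. norm (T i x) \<le> K * norm x"
    and x0: "\<not> ((\<lambda>i. T i x0) \<longlongrightarrow> x0) \<Phi>"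
  shows "\<exists>u :: 'v \<Rightarrow> real. bounded_linear u \<and> u x0 \<noteq> 0 \<and>
    (\<forall>x. ((\<lambda>i. T i x) \<longlongrightarrow> x) \<Phi> \<longrightarrow> u x = 0)"
proof -
  let ?g = "\<lambda>x i. norm (T i x - x)"
  have le: "\<forall>\<^sub>F i in \<Phi>. ?g x i \<le> (K + 1) * norm x" for x
    using K
  proof eventually_elim
    case (elim i)
    have "?g x i \<le> norm (T i x) + norm x" by (rule norm_triangle_ineq4)
    with elim show ?case by (auto simp: algebra_simps intro: order_trans)
  qed
  have b: "fbounded \<Phi> (?g x)" for x
    using le[of x] by (intro fboundedI[where K = "(K + 1) * norm x"]) simp
  have sub: "sublinear (\<lambda>x. flimsup \<Phi> (?g x))"
  proof (rule sublinear_flimsup[OF b])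
    fix x y i and r :: real
    show "?g (x + y) i \<le> ?g x i + ?g y i"
      using norm_triangle_ineq[of "T i x - x" "T i y - y"]
      by (simp add: linear_add[OF T] algebra_simps)
    assume "r \<ge> 0"
    then show "?g (r *\<^sub>R x) i = r * ?g x i"
      by (simp add: linear_scale[OF T] flip: scaleR_diff_right)
  qed
  obtain u where u: "linear u" "\<And>x. u x \<le> flimsup \<Phi> (?g x)" "u x0 = flimsup \<Phi> (?g x0)"
    using hahn_banach[OF sub] by blast
  show ?thesis
  proof (intro exI[of _ u] conjI allI impI)
    show "bounded_linear u"
      by (rule bounded_linear_below_sublinear[OF u(1,2) flimsup_le[OF b le]])
    show "u x0 \<noteq> 0"
    proof
      assume 0: "u x0 = 0"
      have "((\<lambda>i. T i x0) \<longlongrightarrow> x0) \<Phi>"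
      proof (rule tendstoI)
        fix \<epsilon> :: real
        assume "\<epsilon> > 0"
        then show "\<forall>\<^sub>F i in \<Phi>. dist (T i x0) x0 < \<epsilon>"
          using flimsup_less[OF b, of x0 \<epsilon>] 0 u(3) by (simp add: dist_norm)
      qed
      with x0 show False ..
    qed
    fix x
    assume x: "((\<lambda>i. T i x) \<longlongrightarrow> x) \<Phi>"
    then have "(?g x \<longlongrightarrow> 0) \<Phi>" by (simp add: tendsto_norm_zero_iff LIM_zero_iff)
    moreover from this have "(?g (- x) \<longlongrightarrow> 0) \<Phi>"
      by (simp add: linear_neg[OF T] norm_minus_commute)
    ultimately have "u x \<le> 0" "u (- x) \<le> 0"
      using u(2) flimsup_eq_lim by metis+
    then show "u x = 0" using linear_neg[OF u(1)] by simp
  qed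
qed

end

subsection \<open>Cohen's factorization theorem\<close>

lemma convergent_geometric:
  fixes s :: "nat \<Rightarrow> 'v::banach"
  assumes le: "\<And>n. norm (s (Suc n) - s n) \<le> M * r ^ n" and r: "0 \<le> r" "r < 1"
  shows "convergent s"
proof -
  have "summable (\<lambda>n. M * r ^ n)"
    using r by (intro summable_mult summable_geometric) simp
  then have "summable (\<lambda>n. s (Suc n) - s n)"
    by (rule summable_comparison_test') (rule le)
  then have "convergent (\<lambda>n. \<Sum>k<n. s (Suc k) - s k)"
    by (simp add: summable_iff_convergent)
  then have "convergent (\<lambda>n. s n - s 0)"
    by (simp add: sum_lessThan_telescope)
  then obtain l where "(\<lambda>n. s n - s 0) \<longlonglongrightarrow> l" by (auto simp: convergent_def)
  then have "(\<lambda>n. (s n - s 0) + s 0) \<longlonglongrightarrow> l + s 0" by (intro tendsto_intros)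
  then show ?thesis by (auto simp: convergent_def)
qed

text \<open>The lower bound makes \<open>T\<close> injective, so this is a linear bijection whose
  inverse has norm at most \<open>1 / \<delta>\<close>, expressed without the inverse.\<close>

definition iso_below :: "real \<Rightarrow> ('v::real_normed_vector \<Rightarrow> 'v) \<Rightarrow> bool"
  where "iso_below \<delta> T \<longleftrightarrow> linear T \<and> surj T \<and> 0 < \<delta> \<and> (\<forall>y. \<delta> * norm y \<le> norm (T y))"

lemma iso_below_comp:
  assumes "iso_below \<gamma> S" "iso_below \<delta> T"
  shows "iso_below (\<gamma> * \<delta>) (\<lambda>y. S (T y))"
proof -
  have "\<gamma> * \<delta> * norm y \<le> norm (S (T y))" for y
  proof -
    have "\<gamma> * (\<delta> * norm y) \<le> \<gamma> * norm (T y)"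
      using assms by (intro mult_left_mono) (auto simp: iso_below_def)
    also have "\<dots> \<le> norm (S (T y))" using assms by (auto simp: iso_below_def)
    finally show ?thesis by (simp add: mult.assoc)
  qed
  moreover have "linear (\<lambda>y. S (T y))" "surj (\<lambda>y. S (T y))"
    using linear_compose[of T S] comp_surj[of T S] assms
    by (auto simp: iso_below_def comp_def)
  ultimately show ?thesis using assms by (simp add: iso_below_def)
qed

text \<open>The lower bound is the triangle inequality. For surjectivity,
  \<open>T y + D y = x\<close> is the fixed point equation of
  \<open>y \<mapsto> inv T (x - D y)\<close>, a contraction with factor
  \<open>\<eta> / \<delta>\<close>.\<close>

lemma iso_below_add:
  fixes T D :: "'v::banach \<Rightarrow> 'v"
  assumes T: "iso_below \<delta> T" and D: "linear D" "\<And>y. norm (D y) \<le> \<eta> * norm y"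
    and \<eta>: "0 \<le> \<eta>" "\<eta> < \<delta>"
  shows "iso_below (\<delta> - \<eta>) (\<lambda>y. T y + D y)"
proof -
  from T have lin: "linear T" and surj: "surj T" and \<delta>: "\<delta> > 0"
    and below: "\<And>y. \<delta> * norm y \<le> norm (T y)"
    by (auto simp: iso_below_def)
  have "(\<delta> - \<eta>) * norm y \<le> norm (T y + D y)" for y
    using below[of y] D(2)[of y] norm_diff_ineq[of "T y" "D y"] by (simp add: algebra_simps)
  moreover have "\<exists>y. x = T y + D y" for x
  proof -
    define g where "g = (\<lambda>y. inv T (x - D y))"
    have Tg: "T (g y) = x - D y" for y
      unfolding g_def by (rule surj_f_inv_f[OF surj])
    have "dist (g y) (g z) \<le> \<eta> / \<delta> * dist y z" for y z
    proof -
      have "T (g y - g z) = - D (y - z)"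
        by (simp add: linear_diff[OF lin] linear_diff[OF D(1)] Tg)
      then have "\<delta> * norm (g y - g z) \<le> \<eta> * norm (y - z)"
        using below[of "g y - g z"] D(2)[of "y - z"] by simp
      with \<delta> show ?thesis by (simp add: dist_norm field_simps)
    qed
    then have "\<exists>!y. g y = y"
      using \<eta> \<delta> by (intro banach_fix_type[of "\<eta> / \<delta>"]) auto
    then obtain y where "g y = y" by blast
    with Tg[of y] have "x = T y + D y" by (simp add: algebra_simps)
    then show ?thesis ..
  qed
  moreover have "linear (\<lambda>y. T y + D y)" by (rule linear_compose_add[OF lin D(1)])
  ultimately show ?thesis using \<eta> by (auto simp: iso_below_def surj_def)
qed

lemma iso_below_scaleR: "0 < \<alpha> \<Longrightarrow> iso_below \<alpha> (\<lambda>y :: 'v::real_normed_vector. \<alpha> *\<^sub>R y)"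
  by (auto simp: iso_below_def surj_def linear_iff algebra_simps intro: exI[of _ "_ /\<^sub>R \<alpha>"])

text \<open>
  \<open>act\<close> is a right action of an algebra with multiplication \<open>m\<close>; taking for \<open>m\<close> the opposite
  multiplication covers left actions.
\<close>

locale approximately_unital_action = bounded_bilinear act
  for act :: "'v::banach \<Rightarrow> 'a::banach \<Rightarrow> 'v" +
  fixes m :: "'a \<Rightarrow> 'a \<Rightarrow> 'a" and \<Phi> :: "'i filter" and e :: "'i \<Rightarrow> 'a" and K :: real
  assumes act_act: "act (act x a) b = act x (m a b)"
    and nontrivial: "\<Phi> \<noteq> bot"
    and bounded: "\<forall>\<^sub>F i in \<Phi>. norm (e i) \<le> K"
    and approx: "((\<lambda>i. m a (e i)) \<longlongrightarrow> a) \<Phi>"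
begin

text \<open>Write \<open>T z = \<alpha> z + z.b\<close> and \<open>U z = (1 - c) z + c z.u\<close>.
  The new operator is \<open>U T + D\<close> with the error \<open>D z = c z.(b - b u)\<close>. For
  \<open>u = e i\<close> far along the net, \<open>D\<close> is small and \<open>U x\<close> is
  close to \<open>x\<close>, so the new operator is still an isomorphism and its solution
  \<open>y'\<close> is close to \<open>y\<close>.\<close>

lemma cohen_step:
  assumes C: "C > 0" "\<And>x a. norm (act x a) \<le> norm x * norm a * C" and K: "K \<ge> 0"
    and c: "c * (1 + C * K) = 1 / 2" "c > 0"
    and x: "((\<lambda>i. act x (e i)) \<longlongrightarrow> x) \<Phi>"
    and T: "iso_below \<delta> (\<lambda>z. \<alpha> *\<^sub>R z + act z b)" "\<alpha> *\<^sub>R y + act y b = x"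
    and \<epsilon>: "\<epsilon> > 0"
  shows "\<exists>u \<delta>' y'. norm u \<le> K \<and> norm (y' - y) \<le> \<epsilon> \<and>
    iso_below \<delta>' (\<lambda>z. ((1 - c) * \<alpha>) *\<^sub>R z + act z (b + (c * \<alpha>) *\<^sub>R u)) \<and>
    ((1 - c) * \<alpha>) *\<^sub>R y' + act y' (b + (c * \<alpha>) *\<^sub>R u) = x"
proof -
  have \<delta>: "\<delta> > 0" using T(1) by (simp add: iso_below_def)
  \<comment> \<open>\<open>?\<eta> i\<close> will bound the norm of \<open>D\<close>, and
    \<open>?\<theta> i\<close> the norm of \<open>x - (U x + D y)\<close>. Both tend to
    \<open>0\<close>. The threshold \<open>\<delta> / 4\<close> leaves the lower bound
    \<open>\<delta> / 2 - ?\<eta> i\<close> of the new operator above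
    \<open>\<delta> / 4\<close>.\<close>
  let ?\<eta> = "\<lambda>i. c * C * norm (b - m b (e i))"
  let ?\<theta> = "\<lambda>i. c * norm (x - act x (e i)) + ?\<eta> i * norm y"
  have "(?\<eta> \<longlongrightarrow> c * C * norm (b - b)) \<Phi>"
    by (intro tendsto_intros approx)
  moreover from this
  have "(?\<theta> \<longlongrightarrow> c * norm (x - x) + c * C * norm (b - b) * norm y) \<Phi>"
    by (intro tendsto_intros x approx)
  ultimately have "\<forall>\<^sub>F i in \<Phi>. ?\<eta> i < \<delta> / 4" "\<forall>\<^sub>F i in \<Phi>. ?\<theta> i < \<delta> / 4 * \<epsilon>"
    using \<delta> \<epsilon> by (simp_all add: order_tendstoD(2) del: less_divide_eq_numeral1)
  with bounded have "\<forall>\<^sub>F i in \<Phi>. norm (e i) \<le> K \<and> ?\<eta> i < \<delta> / 4 \<and> ?\<theta> i < \<delta> / 4 * \<epsilon>"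
    by eventually_elim simp
  then obtain i where i: "norm (e i) \<le> K" "?\<eta> i < \<delta> / 4" "?\<theta> i < \<delta> / 4 * \<epsilon>"
    using eventually_happens'[OF nontrivial] by blast
  define u where "u = e i"
  define D where "D = (\<lambda>z. c *\<^sub>R act z (b - m b u))"
  define U where "U = (\<lambda>z. (1 - c) *\<^sub>R z + c *\<^sub>R act z u)"
  \<comment> \<open>\<open>U\<close> is the scaling by \<open>1 - c\<close> plus a perturbation of
    norm at most \<open>c * C * K\<close>; the value of \<open>c\<close> makes its lower bound
    exactly \<open>1 / 2\<close>.\<close>
  have c1: "1 - c - c * C * K = 1 / 2" using c(1) by (simp add: algebra_simps)
  have "c * C * K \<ge> 0" using c C K by simp
  then have c_less: "c * C * K < 1 - c" using c1 by linarith
  have "c < 1" using c_less \<open>c * C * K \<ge> 0\<close> by linarith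
  have D_le: "norm (D z) \<le> ?\<eta> i * norm z" for z
    using mult_left_mono[OF C(2)[of z "b - m b u"], of c] c(2) by (simp add: D_def u_def mult_ac)
  have "norm (c *\<^sub>R act z u) \<le> c * C * K * norm z" for z
  proof -
    have "norm (act z u) \<le> norm z * K * C"
      by (rule order_trans[OF C(2)], intro mult_right_mono mult_left_mono)
        (use i(1) C(1) in \<open>auto simp: u_def\<close>)
    from mult_left_mono[OF this, of c] c(2) show ?thesis by (simp add: mult_ac)
  qed
  moreover have "linear (\<lambda>z. c *\<^sub>R act z u)"
    by (simp add: linear_iff add_left scaleR_left algebra_simps)
  ultimately have "iso_below (1 - c - c * C * K) U"
    unfolding U_def using \<open>c < 1\<close> c_less c C K
    by (intro iso_below_add iso_below_scaleR) auto
  from iso_below_comp[OF this[unfolded c1] T(1)]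
  have "iso_below (\<delta> / 2) (\<lambda>z. U (\<alpha> *\<^sub>R z + act z b))" by simp
  moreover have "linear D"
    by (simp add: D_def linear_iff add_left scaleR_left algebra_simps)
  ultimately have iso: "iso_below (\<delta> / 2 - ?\<eta> i) (\<lambda>z. U (\<alpha> *\<^sub>R z + act z b) + D z)"
    using i(2) \<delta> c C by (intro iso_below_add D_le) auto
  have eq: "U (\<alpha> *\<^sub>R z + act z b) + D z = ((1 - c) * \<alpha>) *\<^sub>R z + act z (b + (c * \<alpha>) *\<^sub>R u)" for z
    by (simp add: U_def D_def add_left add_right scaleR_left scaleR_right diff_right act_act algebra_simps)
  note iso' = iso[unfolded eq]
  then obtain y' where y': "((1 - c) * \<alpha>) *\<^sub>R y' + act y' (b + (c * \<alpha>) *\<^sub>R u) = x"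
    unfolding iso_below_def surj_def by metis
  let ?T = "\<lambda>z. ((1 - c) * \<alpha>) *\<^sub>R z + act z (b + (c * \<alpha>) *\<^sub>R u)"
  \<comment> \<open>The new operator sends \<open>y'\<close> to \<open>x\<close> and
    \<open>y\<close> to \<open>U x + D y\<close>, so its lower bound turns the smallness of
    \<open>?\<theta> i\<close> into closeness of \<open>y'\<close> to \<open>y\<close>.\<close>
  have "\<delta> / 4 * norm (y' - y) \<le> (\<delta> / 2 - ?\<eta> i) * norm (y' - y)"
    using i(2) by (intro mult_right_mono) auto
  also have "\<dots> \<le> norm (?T (y' - y))" using iso' by (simp add: iso_below_def)
  also have "?T (y' - y) = ?T y' - ?T y"
    by (simp add: diff_left algebra_simps)
  also have "\<dots> = x - (U x + D y)" using eq[of y] by (simp add: T(2) y')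
  also have "\<dots> = c *\<^sub>R (x - act x u) - D y"
    by (simp add: U_def algebra_simps)
  also have "norm \<dots> \<le> norm (c *\<^sub>R (x - act x u)) + norm (D y)" by (rule norm_triangle_ineq4)
  also have "\<dots> \<le> ?\<theta> i" using D_le[of y] c(2) by (simp add: u_def)
  also have "\<dots> < \<delta> / 4 * \<epsilon>" by (rule i(3))
  finally have "norm (y' - y) \<le> \<epsilon>" using \<delta> by simp
  with iso' y' i(1) show ?thesis unfolding u_def by blast
qed

text \<open>Iterating \<open>cohen_step\<close> gives
  \<open>x = (1 - c) ^ n y n + (y n).(b n)\<close>. The increments of \<open>b\<close> are at most
  \<open>c * K * (1 - c) ^ n\<close> and those of \<open>y\<close> at most
  \<open>(1 / 2) ^ n\<close>, so both sequences converge; the scalar term dies out and the limit is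
  the factorization.\<close>

theorem cohen_factorization:
  assumes x: "((\<lambda>i. act x (e i)) \<longlongrightarrow> x) \<Phi>"
  shows "\<exists>y a. x = act y a"
proof -
  obtain C where C: "C > 0" "\<And>x a. norm (act x a) \<le> norm x * norm a * C"
    using pos_bounded by blast
  have K: "K \<ge> 0"
    using eventually_happens'[OF nontrivial bounded] by (meson norm_ge_zero order_trans)
  define c where "c = 1 / (2 * (1 + C * K))"
  have pos: "1 + C * K \<ge> 1" using C K by simp
  then have c: "c * (1 + C * K) = 1 / 2" "c > 0" by (auto simp: c_def field_simps)
  have "c * 1 \<le> c * (1 + C * K)" using pos c(2) by (intro mult_left_mono) auto
  then have c1: "c < 1" unfolding c(1) by simp
  define P where "P = (\<lambda>n (b, y). \<exists>\<delta>. iso_below \<delta> (\<lambda>z. (1 - c) ^ n *\<^sub>R z + act z b) \<and>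
    (1 - c) ^ n *\<^sub>R y + act y b = x)"
  define Q where "Q = (\<lambda>n p q. norm (fst q - fst p :: 'a) \<le> c * K * (1 - c) ^ n \<and>
    norm (snd q - snd p :: 'v) \<le> 1 * (1 / 2 :: real) ^ n)"
  have "\<exists>f. \<forall>n. P n (f n) \<and> Q n (f n) (f (Suc n))"
  proof (rule dependent_nat_choice)
    \<comment> \<open>With \<open>b = 0\<close> and \<open>y = x\<close> the initial operator is the
      identity.\<close>
    have "P 0 (0, x)"
      using iso_below_scaleR[of 1] by (auto simp: P_def zero_right)
    then show "\<exists>p. P 0 p" ..
  next
    fix p n
    assume "P n p"
    moreover obtain b y where p: "p = (b, y)" by (cases p)
    ultimately obtain \<delta> where "iso_below \<delta> (\<lambda>z. (1 - c) ^ n *\<^sub>R z + act z b)"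
      "(1 - c) ^ n *\<^sub>R y + act y b = x" by (auto simp: P_def)
    from cohen_step[OF C K c x this, of "(1 / 2) ^ n"]
    obtain u \<delta>' y' where u: "norm u \<le> K" "norm (y' - y) \<le> (1 / 2) ^ n"
      "iso_below \<delta>' (\<lambda>z. (1 - c) ^ Suc n *\<^sub>R z + act z (b + (c * (1 - c) ^ n) *\<^sub>R u))"
      "(1 - c) ^ Suc n *\<^sub>R y' + act y' (b + (c * (1 - c) ^ n) *\<^sub>R u) = x" by auto
    have "c * (1 - c) ^ n * norm u \<le> c * (1 - c) ^ n * K"
      using c(2) c1 u(1) by (intro mult_left_mono) auto
    then have "norm ((c * (1 - c) ^ n) *\<^sub>R u) \<le> c * K * (1 - c) ^ n"
      using c(2) c1 by (simp add: mult_ac abs_mult)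
    with u show "\<exists>q. P (Suc n) q \<and> Q n p q"
      by (intro exI[of _ "(b + (c * (1 - c) ^ n) *\<^sub>R u, y')"]) (auto simp: P_def Q_def p)
  qed
  then obtain f where f: "\<And>n. P n (f n)" "\<And>n. Q n (f n) (f (Suc n))" by blast
  define b y where "b = (\<lambda>n. fst (f n))" and "y = (\<lambda>n. snd (f n))"
  have "convergent b"
    by (rule convergent_geometric[of _ "c * K" "1 - c"])
      (use f(2) c c1 in \<open>auto simp: Q_def b_def\<close>)
  then obtain a where a: "b \<longlonglongrightarrow> a" by (auto simp: convergent_def)
  have "convergent y"
    by (rule convergent_geometric[of _ 1 "1 / 2"])
      (use f(2) in \<open>auto simp: Q_def y_def\<close>)
  then obtain z where z: "y \<longlonglongrightarrow> z" by (auto simp: convergent_def)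
  have "(\<lambda>n. (1 - c) ^ n *\<^sub>R y n + act (y n) (b n)) \<longlonglongrightarrow> 0 *\<^sub>R z + act z a"
    using c c1 by (intro tendsto_intros tendsto a z LIMSEQ_power_zero) auto
  moreover have "(1 - c) ^ n *\<^sub>R y n + act (y n) (b n) = x" for n
    using f(1)[of n] by (auto simp: P_def b_def y_def split: prod.splits)
  ultimately have "x = 0 *\<^sub>R z + act z a"
    by (simp add: LIMSEQ_const_iff)
  then show ?thesis by auto
qed

end

subsection \<open>Real parts of scalars\<close>

text \<open>
  \<open>imag_unit\<close> is \<open>0\<close> over the reals, so that the formulas below cover both scalar fields.
\<close>

definition imag_unit :: "'k::real_or_complex"
  where "imag_unit = (SOME i. (i = 0 \<or> i * i = -1) \<and> (\<forall>z. \<exists>x y. z = of_real x + of_real y * i))"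

lemma imag_unit_cases: "imag_unit = (0 :: 'k::real_or_complex) \<or> imag_unit * imag_unit = (-1 :: 'k)"
  and scalar_decomp: "\<exists>x y. (z :: 'k) = of_real x + of_real y * imag_unit"
proof -
  have "\<exists>i::'k. (i = 0 \<or> i * i = -1) \<and> (\<forall>z. \<exists>x y. z = of_real x + of_real y * i)"
    using real_or_complex[where 'a = 'k]
  proof
    assume "\<forall>z::'k. \<exists>x. z = x *\<^sub>R 1"
    then show ?thesis by (intro exI[of _ 0]) (auto simp: of_real_def)
  qed (auto simp: scaleR_conv_of_real)
  from someI_ex[OF this] show "imag_unit = (0::'k) \<or> imag_unit * imag_unit = (-1 :: 'k)"
    and "\<exists>x y. z = of_real x + of_real y * imag_unit"
    unfolding imag_unit_def by blast+
qed

definition real_part :: "'k::real_or_complex \<Rightarrow> real"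
  where "real_part z = (SOME x. \<exists>y. z = of_real x + of_real y * imag_unit)"

text \<open>Two decompositions of one scalar make a real number equal to a real multiple of
  \<open>imag_unit\<close>. Squaring then gives a vanishing sum of two real squares, so the choice
  in \<open>real_part\<close> is unambiguous.\<close>

lemma real_part_eq [simp]: "real_part (of_real x + of_real y * imag_unit :: 'k::real_or_complex) = x"
proof -
  have "x' = x" if eq: "of_real x + of_real y * imag_unit = (of_real x' + of_real y' * imag_unit :: 'k)"
    for x' y'
    using imag_unit_cases[where 'k = 'k]
  proof
    assume i: "imag_unit * imag_unit = (-1 :: 'k)"
    have eq': "of_real (x - x') = (of_real (y' - y) * imag_unit :: 'k)"
      using eq by (simp add: algebra_simps)
    have "of_real ((x - x') * (x - x')) = (of_real (x - x') * of_real (x - x') :: 'k)"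
      by (rule of_real_mult)
    also have "\<dots> = of_real (y' - y) * of_real (y' - y) * (imag_unit * imag_unit)"
      unfolding eq' by (simp only: mult_ac)
    also have "\<dots> = of_real (- ((y' - y) * (y' - y)))" by (simp add: i)
    finally have "(x - x') * (x - x') = - ((y' - y) * (y' - y))" by (simp only: of_real_eq_iff)
    then have "(x - x')\<^sup>2 + (y' - y)\<^sup>2 = 0" by (simp add: power2_eq_square)
    then show ?thesis by (simp add: sum_power2_eq_zero_iff)
  qed (use eq in simp)
  then show ?thesis
    unfolding real_part_def by (intro some_equality) (auto dest: sym)
qed

lemma real_part_of_real [simp]: "real_part (of_real x) = x"
  using real_part_eq[of x 0] by simp

lemma real_part_add: "real_part (z + w) = real_part z + real_part w"
proof -
  obtain x y x' y' where "z = of_real x + of_real y * imag_unit"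
    "w = of_real x' + of_real y' * imag_unit"
    using scalar_decomp by metis
  moreover from this have "z + w = of_real (x + x') + of_real (y + y') * imag_unit"
    by (simp add: algebra_simps)
  ultimately show ?thesis by (simp only: real_part_eq)
qed

lemma real_part_scaleR: "real_part (r *\<^sub>R z) = r * real_part z"
proof -
  obtain x y where "z = of_real x + of_real y * imag_unit" using scalar_decomp by metis
  moreover from this have "r *\<^sub>R z = of_real (r * x) + of_real (r * y) * imag_unit"
    by (simp add: scaleR_conv_of_real algebra_simps)
  ultimately show ?thesis by (simp only: real_part_eq)
qed

text \<open>Only continuity of \<open>real_part\<close> matters, so the constant \<open>2\<close>
  need not be sharp. It comes from multiplicativity of the norm, applied to \<open>z\<close> times
  its conjugate.\<close>

lemma abs_real_part_le: "\<bar>real_part z\<bar> \<le> norm (z :: 'k::real_or_complex) * 2"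
proof -
  obtain x y where z: "z = of_real x + of_real y * imag_unit" using scalar_decomp by metis
  have "\<bar>x\<bar> \<le> norm z * 2"
    using imag_unit_cases[where 'k = 'k]
  proof
    assume i: "imag_unit * imag_unit = (-1 :: 'k)"
    have "norm (imag_unit * imag_unit :: 'k) = 1" by (simp add: i)
    then have "(norm (imag_unit :: 'k))\<^sup>2 = 1\<^sup>2" by (simp add: norm_mult power2_eq_square)
    then have ni: "norm (imag_unit :: 'k) = 1" by (rule power2_eq_imp_eq) auto
    let ?w = "of_real x - of_real y * imag_unit :: 'k"
    have "z * ?w = of_real x * of_real x - of_real y * of_real y * (imag_unit * imag_unit)"
      by (simp add: z algebra_simps)
    also have "\<dots> = of_real (x\<^sup>2 + y\<^sup>2)" by (simp add: i power2_eq_square)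
    finally have "norm z * norm ?w = norm (of_real (x\<^sup>2 + y\<^sup>2) :: 'k)" by (metis norm_mult)
    then have "norm z * norm ?w = x\<^sup>2 + y\<^sup>2" unfolding norm_of_real by simp
    moreover have "norm ?w \<le> \<bar>x\<bar> + \<bar>y\<bar>"
      using norm_triangle_ineq4[of "of_real x :: 'k" "of_real y * imag_unit"]
      by (simp add: norm_mult ni)
    ultimately have le: "x\<^sup>2 + y\<^sup>2 \<le> norm z * (\<bar>x\<bar> + \<bar>y\<bar>)"
      by (metis mult_left_mono norm_ge_zero)
    show ?thesis
    proof (rule ccontr)
      assume "\<not> ?thesis"
      then have lt: "norm z \<le> \<bar>x\<bar> / 2" and x: "x \<noteq> 0" using norm_ge_zero[of z] by auto
      have "norm z * (\<bar>x\<bar> + \<bar>y\<bar>) \<le> \<bar>x\<bar> / 2 * (\<bar>x\<bar> + \<bar>y\<bar>)"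
        using lt by (intro mult_right_mono) auto
      with le have "\<bar>x\<bar>\<^sup>2 + \<bar>y\<bar>\<^sup>2 \<le> \<bar>x\<bar> / 2 * (\<bar>x\<bar> + \<bar>y\<bar>)" by simp
      \<comment> \<open>The square absorbs the mixed term
        \<open>\<bar>x\<bar> * \<bar>y\<bar> / 2\<close>, leaving
        \<open>x\<^sup>2 \<le> 9 / 16 * x\<^sup>2\<close>.\<close>
      moreover have "(\<bar>x\<bar> / 4 - \<bar>y\<bar>)\<^sup>2 \<ge> 0" "\<bar>x\<bar>\<^sup>2 > 0" using x by auto
      ultimately show False by (simp add: power2_eq_square algebra_simps)
    qed
  qed (simp add: z)
  with z show ?thesis by simp
qed

lemma bounded_linear_real_part: "bounded_linear real_part"
  by (rule bounded_linear_intro[of _ 2])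
    (simp_all add: real_part_add real_part_scaleR abs_real_part_le)

text \<open>The real part of \<open>imag_unit * z\<close> is minus the imaginary part of
  \<open>z\<close>. Questions about scalars thereby reduce to real parts, those of \<open>z\<close>
  and of \<open>imag_unit * z\<close>.\<close>

lemma scalar_eq_real_parts:
  "z = of_real (real_part z) - imag_unit * of_real (real_part (imag_unit * z))"
  for z :: "'k::real_or_complex"
proof -
  obtain x y where z: "z = of_real x + of_real y * imag_unit" using scalar_decomp by metis
  show ?thesis
    using imag_unit_cases[where 'k = 'k]
  proof
    assume i: "imag_unit * imag_unit = (-1 :: 'k)"
    have "imag_unit * z = of_real x * imag_unit + of_real y * (imag_unit * imag_unit)"
      by (simp add: z algebra_simps)
    also have "\<dots> = of_real (- y) + of_real x * imag_unit" by (simp add: i)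
    finally have "real_part (imag_unit * z) = - y" by (simp only: real_part_eq)
    then show ?thesis by (simp add: z)
  qed (simp add: z)
qed

text \<open>Complete scalars make \<open>'a \<Rightarrow>\<^sub>L 'k\<close> a Banach space, on
  which Cohen's theorem is used later.\<close>

instance real_or_complex \<subseteq> banach
proof
  fix X :: "nat \<Rightarrow> 'a"
  assume X: "Cauchy X"
  have "convergent (\<lambda>n. real_part (w * X n))" for w
    using bounded_linear.Cauchy[OF bounded_linear_compose[OF bounded_linear_real_part
        bounded_linear_mult_right] X, of w]
    by (simp add: real_Cauchy_convergent)
  then obtain l where l: "\<And>w. (\<lambda>n. real_part (w * X n)) \<longlonglongrightarrow> l w"
    unfolding convergent_def by metis
  have "(\<lambda>n. of_real (real_part (1 * X n)) - imag_unit * of_real (real_part (imag_unit * X n)))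
      \<longlonglongrightarrow> (of_real (l 1) :: 'a) - imag_unit * of_real (l imag_unit)"
    by (intro tendsto_intros l)
  then show "convergent X"
    unfolding mult_1_left scalar_eq_real_parts[symmetric] by (rule convergentI)
qed

text \<open>The classical formula \<open>u x - i u (i x)\<close> for the complex-linear functional
  with real part \<open>u\<close>; over the reals it is \<open>u\<close> itself.\<close>

definition scalar_extension ::
    "('k::real_or_complex \<Rightarrow> 'v \<Rightarrow> 'v) \<Rightarrow> ('v::real_normed_vector \<Rightarrow> real) \<Rightarrow> 'v \<Rightarrow> 'k"
  where "scalar_extension s u x =
    of_real (u x) - imag_unit * of_real (u (s imag_unit x))"

lemma scalar_extension:
  fixes s :: "'k::real_or_complex \<Rightarrow> 'v::real_normed_vector \<Rightarrow> 'v"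
  assumes s: "vector_space s" "\<And>r x. s (of_real r) x = r *\<^sub>R x" "bounded_linear (s imag_unit)"
    and u: "bounded_linear u"
  shows "bounded_linear (scalar_extension s u)"
    and "scalar_extension s u (s c x) = c * scalar_extension s u x"
    and "real_part (scalar_extension s u x) = u x"
proof -
  interpret s: vector_space s by fact
  interpret u: bounded_linear u by fact
  interpret F: bounded_linear "scalar_extension s u"
    unfolding scalar_extension_def
    by (intro bounded_linear_sub bounded_linear_compose[OF bounded_linear_mult_right]
        bounded_linear_compose[OF bounded_linear_of_real] u bounded_linear_compose[OF u] s(3))
  show "bounded_linear (scalar_extension s u)" ..
  have i: "scalar_extension s u (s imag_unit x) = imag_unit * scalar_extension s u x"
    using imag_unit_cases[where 'k = 'k]
  proof
    assume i: "imag_unit * imag_unit = (-1 :: 'k)"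
    have "s (-1) x = - x" using s(2)[of "-1" x] by simp
    then have "scalar_extension s u (s imag_unit x) =
        of_real (u (s imag_unit x)) + imag_unit * of_real (u x)"
      by (simp add: scalar_extension_def i u.neg)
    also have "\<dots> = imag_unit * of_real (u x) - (imag_unit * imag_unit) * of_real (u (s imag_unit x))"
      by (simp add: i)
    also have "\<dots> = imag_unit * scalar_extension s u x"
      by (simp add: scalar_extension_def algebra_simps)
    finally show ?thesis .
  next
    assume "imag_unit = (0 :: 'k)"
    then show ?thesis by (simp add: F.zero)
  qed
  obtain a b where c: "c = of_real a + of_real b * imag_unit" using scalar_decomp by metis
  have "s c x = a *\<^sub>R x + b *\<^sub>R s imag_unit x"
    by (simp add: c s.scale_left_distrib s(2) flip: s.scale_scale)
  then show "scalar_extension s u (s c x) = c * scalar_extension s u x"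
    by (simp add: F.add F.scaleR i c scaleR_conv_of_real algebra_simps)
  have "scalar_extension s u x = of_real (u x) + of_real (- u (s imag_unit x)) * imag_unit"
    by (simp add: scalar_extension_def mult.commute)
  then show "real_part (scalar_extension s u x) = u x" by (simp only: real_part_eq)
qed

subsection \<open>The dual and the bidual\<close>

text \<open>The set \<open>dual smul\<close> embeds by \<open>Blinfun\<close> into the normed space
  of all bounded real-linear maps, where Hahn-Banach and Cohen's theorem apply. This operation
  supplies the scalars of \<open>'k\<close> there.\<close>

definition blinfun_smul :: "'k::real_or_complex \<Rightarrow> ('a::real_normed_vector \<Rightarrow>\<^sub>L 'k) \<Rightarrow> 'a \<Rightarrow>\<^sub>L 'k"
  where "blinfun_smul c f = blinfun_mult_right c o\<^sub>L f"

lemma blinfun_smul_apply [simp]: "blinfun_smul c f a = c * f a"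
  by (simp add: blinfun_smul_def blinfun_mult_right.rep_eq)

lemma vector_space_blinfun_smul: "vector_space blinfun_smul"
  by unfold_locales (auto intro!: blinfun_eqI simp: blinfun.bilinear_simps algebra_simps)

lemma blinfun_smul_of_real: "blinfun_smul (of_real r) f = r *\<^sub>R f"
  by (rule blinfun_eqI) (simp add: blinfun.bilinear_simps scaleR_conv_of_real)

lemma bounded_linear_blinfun_smul: "bounded_linear (blinfun_smul c)"
  unfolding blinfun_smul_def
  by (rule bounded_bilinear.bounded_linear_right[OF bounded_bilinear_blinfun_compose])

context banach_algebra
begin

lemma dual_iff: "f \<in> dual smul \<longleftrightarrow>
    (\<forall>a b. f (a + b) = f a + f b) \<and> (\<forall>c a. f (smul c a) = c * f a) \<and>
    (\<exists>K. \<forall>a. norm (f a) \<le> K * norm a)"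
proof -
  have "vector_space ((*) :: 'k \<Rightarrow> 'k \<Rightarrow> 'k)" by unfold_locales (auto simp: algebra_simps)
  with vector_space_axioms show ?thesis by (auto simp: dual_def Vector_Spaces.linear_iff)
qed

lemma dual_add: "f \<in> dual smul \<Longrightarrow> f (a + b) = f a + f b"
  and dual_smul: "f \<in> dual smul \<Longrightarrow> f (smul c a) = c * f a"
  by (auto simp: dual_iff)

lemma dual_bounded_linear:
  assumes "f \<in> dual smul"
  shows "bounded_linear f"
proof -
  obtain K where "\<And>a. norm (f a) \<le> K * norm a" using assms by (auto simp: dual_iff)
  moreover have "f (r *\<^sub>R a) = r *\<^sub>R f a" for r a
    using dual_smul[OF assms, of "of_real r" a] by (simp add: smul_of_real scaleR_conv_of_real)
  ultimately show ?thesis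
    by (intro bounded_linear_intro[of _ K]) (simp_all add: dual_add[OF assms] mult.commute)
qed

lemma dualI:
  assumes "bounded_linear f" "\<And>c a. f (smul c a) = c * f a"
  shows "f \<in> dual smul"
proof -
  interpret bounded_linear f by fact
  show ?thesis using nonneg_bounded assms(2) by (auto simp: dual_iff add mult.commute)
qed

lemma Blinfun_apply [simp]: "f \<in> dual smul \<Longrightarrow> blinfun_apply (Blinfun f) = f"
  by (simp add: bounded_linear_Blinfun_apply dual_bounded_linear)

lemma onorm_dual: "f \<in> dual smul \<Longrightarrow> onorm f = norm (Blinfun f)"
  by (simp add: norm_blinfun.rep_eq)

lemma bounded_linear_smul: "bounded_linear (smul c)"
proof (rule bounded_linear_intro[of _ "norm c"])
  fix r a
  show "smul c (r *\<^sub>R a) = r *\<^sub>R smul c a"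
    by (metis mult.commute scale_scale smul_of_real)
qed (simp_all add: scale_right_distrib norm_smul mult.commute)

lemma dual_sum: "f \<in> dual smul \<Longrightarrow> g \<in> dual smul \<Longrightarrow> (\<lambda>a. f a + g a) \<in> dual smul"
  by (rule dualI) (auto intro: bounded_linear_add dual_bounded_linear simp: dual_smul algebra_simps)

lemma dual_scale: "f \<in> dual smul \<Longrightarrow> (\<lambda>a. c * f a) \<in> dual smul"
  by (rule dualI)
    (auto intro: bounded_linear_compose[OF bounded_linear_mult_right] dual_bounded_linear
      simp: dual_smul algebra_simps)

lemma dual_act1_in_dual: "f \<in> dual smul \<Longrightarrow> dual_act1 f a \<in> dual smul"
  unfolding dual_act1_def
  by (rule dualI)
    (auto intro: bounded_linear_compose[OF dual_bounded_linear bounded_linear_mult_right]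
      simp: dual_smul smul_mult_right)

lemma dual_act2_in_dual: "f \<in> dual smul \<Longrightarrow> dual_act2 a f \<in> dual smul"
  unfolding dual_act2_def
  by (rule dualI)
    (auto intro: bounded_linear_compose[OF dual_bounded_linear bounded_linear_mult_left]
      simp: dual_smul smul_mult_left)

lemma bidual_add: "F \<in> bidual smul \<Longrightarrow> f \<in> dual smul \<Longrightarrow> g \<in> dual smul \<Longrightarrow>
    F (\<lambda>a. f a + g a) = F f + F g"
  and bidual_scale: "F \<in> bidual smul \<Longrightarrow> f \<in> dual smul \<Longrightarrow> F (\<lambda>a. c * f a) = c * F f"
  by (auto simp: bidual_def)

lemma bidual_bound:
  assumes "F \<in> bidual smul"
  obtains K where "K \<ge> 0" "\<And>f. f \<in> dual smul \<Longrightarrow> norm (F f) \<le> K * onorm f"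
proof -
  obtain K where K: "\<And>f. f \<in> dual smul \<Longrightarrow> norm (F f) \<le> K * onorm f"
    using assms unfolding bidual_def by blast
  have "norm (F f) \<le> \<bar>K\<bar> * onorm f" if "f \<in> dual smul" for f
  proof -
    have "K * onorm f \<le> \<bar>K\<bar> * onorm f"
      by (intro mult_right_mono onorm_pos_le dual_bounded_linear that) simp
    with K[OF that] show ?thesis by linarith
  qed
  then show thesis by (intro that[of "\<bar>K\<bar>"]) auto
qed

lemma bidual_ext:
  assumes "F \<in> extensional (dual smul)" "G \<in> extensional (dual smul)"
    and "\<And>f. f \<in> dual smul \<Longrightarrow> F f = G f"
  shows "F = G"
  using assms by (intro extensionalityI)

lemma bidual_act1_in_dual:
  assumes F: "F \<in> bidual smul" and f: "f \<in> dual smul"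
  shows "bidual_act1 F f \<in> dual smul"
proof -
  obtain K where K: "K \<ge> 0" "\<And>f. f \<in> dual smul \<Longrightarrow> norm (F f) \<le> K * onorm f"
    using bidual_bound[OF F] by blast
  have "dual_act1 f (a + b) = (\<lambda>c. dual_act1 f a c + dual_act1 f b c)"
    "dual_act1 f (smul c a) = (\<lambda>b. c * dual_act1 f a b)" for a b c
    by (simp_all add: dual_act1_def fun_eq_iff distrib_right dual_add[OF f] smul_mult_left dual_smul[OF f])
  moreover have "norm (F (dual_act1 f a)) \<le> K * onorm f * norm a" for a
  proof -
    have "onorm (dual_act1 f a) \<le> onorm f * norm a"
    proof (rule onorm_bound)
      fix b
      have "norm (f (a * b)) \<le> onorm f * norm (a * b)"
        by (rule onorm[OF dual_bounded_linear[OF f]])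
      also have "\<dots> \<le> onorm f * (norm a * norm b)"
        by (intro mult_left_mono norm_mult_ineq onorm_pos_le dual_bounded_linear f)
      finally show "norm (dual_act1 f a b) \<le> onorm f * norm a * norm b"
        by (simp add: dual_act1_def mult.assoc)
    qed (simp add: onorm_pos_le dual_bounded_linear f)
    then have "K * onorm (dual_act1 f a) \<le> K * (onorm f * norm a)"
      using K(1) by (rule mult_left_mono)
    with K(2)[OF dual_act1_in_dual[OF f]] show ?thesis by (metis mult.assoc order_trans)
  qed
  ultimately show ?thesis
    unfolding dual_iff
    by (auto simp: bidual_act1_def bidual_add[OF F] bidual_scale[OF F] dual_act1_in_dual f)
qed

lemma bidual_act2_in_dual:
  assumes F: "F \<in> bidual smul" and f: "f \<in> dual smul"
  shows "bidual_act2 f F \<in> dual smul"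
proof -
  obtain K where K: "K \<ge> 0" "\<And>f. f \<in> dual smul \<Longrightarrow> norm (F f) \<le> K * onorm f"
    using bidual_bound[OF F] by blast
  have "dual_act2 (a + b) f = (\<lambda>c. dual_act2 a f c + dual_act2 b f c)"
    "dual_act2 (smul c a) f = (\<lambda>b. c * dual_act2 a f b)" for a b c
    by (simp_all add: dual_act2_def fun_eq_iff distrib_left dual_add[OF f] smul_mult_right dual_smul[OF f])
  moreover have "norm (F (dual_act2 a f)) \<le> K * onorm f * norm a" for a
  proof -
    have "onorm (dual_act2 a f) \<le> onorm f * norm a"
    proof (rule onorm_bound)
      fix b
      have "norm (f (b * a)) \<le> onorm f * norm (b * a)"
        by (rule onorm[OF dual_bounded_linear[OF f]])
      also have "\<dots> \<le> onorm f * (norm b * norm a)"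
        by (intro mult_left_mono norm_mult_ineq onorm_pos_le dual_bounded_linear f)
      finally show "norm (dual_act2 a f b) \<le> onorm f * norm a * norm b"
        by (simp add: dual_act2_def mult_ac)
    qed (simp add: onorm_pos_le dual_bounded_linear f)
    then have "K * onorm (dual_act2 a f) \<le> K * (onorm f * norm a)"
      using K(1) by (rule mult_left_mono)
    with K(2)[OF dual_act2_in_dual[OF f]] show ?thesis by (metis mult.assoc order_trans)
  qed
  ultimately show ?thesis
    unfolding dual_iff
    by (auto simp: bidual_act2_def bidual_add[OF F] bidual_scale[OF F] dual_act2_in_dual f)
qed

lemma ex_dual_real_part:
  assumes "bounded_linear u"
  shows "\<exists>f\<in>dual smul. \<forall>a. real_part (f a) = u a"
  using scalar_extension[OF vector_space_axioms smul_of_real bounded_linear_smul assms]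
  by (intro bexI[of _ "scalar_extension smul u"] dualI) auto

text \<open>Hahn-Banach yields real functionals on all bounded real-linear maps; the scalar
  extension of such a functional, restricted to the dual, is an element of the bidual.\<close>

lemma ex_bidual_real_part:
  fixes u :: "('a \<Rightarrow>\<^sub>L 'k) \<Rightarrow> real"
  assumes "bounded_linear u"
  shows "\<exists>F\<in>bidual smul. \<forall>f\<in>dual smul. real_part (F f) = u (Blinfun f)"
proof -
  let ?F = "scalar_extension blinfun_smul u"
  note ext = scalar_extension[OF vector_space_blinfun_smul blinfun_smul_of_real
      bounded_linear_blinfun_smul assms]
  interpret F: bounded_linear ?F by (rule ext(1))
  obtain K where K: "\<And>x. norm (?F x) \<le> norm x * K" using F.bounded by blast
  have "Blinfun (\<lambda>a. f a + g a) = Blinfun f + Blinfun g"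
    if "f \<in> dual smul" "g \<in> dual smul" for f g
    using that by (intro blinfun_eqI) (simp add: dual_sum blinfun.add_left)
  moreover have "Blinfun (\<lambda>a. c * f a) = blinfun_smul c (Blinfun f)" if "f \<in> dual smul" for f c
    using that by (intro blinfun_eqI) (simp add: dual_scale)
  ultimately have "(\<lambda>f\<in>dual smul. ?F (Blinfun f)) \<in> bidual smul"
    using K by (auto simp: bidual_def dual_sum dual_scale F.add ext(2) onorm_dual mult.commute
        intro!: exI[of _ K])
  then show ?thesis
    by (intro bexI[of _ "\<lambda>f\<in>dual smul. ?F (Blinfun f)"]) (auto simp: ext(3))
qed

text \<open>This takes the place of a weak-star cluster point of \<open>x\<close> in the bidual:
  \<open>F\<close> is constrained only at those functionals along which \<open>x\<close>
  converges.\<close>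

definition limit_functional :: "'j filter \<Rightarrow> ('j \<Rightarrow> 'a) \<Rightarrow> (('a \<Rightarrow> 'k) \<Rightarrow> 'k) \<Rightarrow> bool"
  where "limit_functional \<Phi> x F \<longleftrightarrow> F \<in> bidual smul \<and>
    (\<forall>f\<in>dual smul. \<forall>l. ((\<lambda>i. f (x i)) \<longlongrightarrow> l) \<Phi> \<longrightarrow> F f = l)"

lemma limit_functional_bidual: "limit_functional \<Phi> x F \<Longrightarrow> F \<in> bidual smul"
  and limit_functional_eq: "limit_functional \<Phi> x F \<Longrightarrow> f \<in> dual smul \<Longrightarrow>
    ((\<lambda>i. f (x i)) \<longlongrightarrow> l) \<Phi> \<Longrightarrow> F f = l"
  by (auto simp: limit_functional_def)

text \<open>Domination by the upper limit at \<open>f\<close> and at \<open>- f\<close> pins the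
  value down whenever the limit exists. Attaining the upper limit at a chosen \<open>f0\<close> is
  what later detects convergence of \<open>f0 (x n)\<close>.\<close>

lemma ex_limit_functional:
  fixes x :: "'j \<Rightarrow> 'a"
  assumes \<Phi>: "\<Phi> \<noteq> bot" and K: "\<forall>\<^sub>F i in \<Phi>. norm (x i) \<le> K" and f0: "f0 \<in> dual smul"
  obtains F where "limit_functional \<Phi> x F"
    and "real_part (F f0) = flimsup \<Phi> (\<lambda>i. real_part (f0 (x i)))"
proof -
  interpret re: bounded_linear "real_part :: 'k \<Rightarrow> real" by (rule bounded_linear_real_part)
  let ?g = "\<lambda>(f :: 'a \<Rightarrow>\<^sub>L 'k) i. real_part (f (x i))"
  have le: "\<forall>\<^sub>F i in \<Phi>. \<bar>?g f i\<bar> \<le> 2 * K * norm f" for f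
    using K
  proof eventually_elim
    case (elim i)
    have "\<bar>?g f i\<bar> \<le> norm (f (x i)) * 2" by (rule abs_real_part_le)
    also have "norm (f (x i)) \<le> norm f * norm (x i)" by (rule norm_blinfun)
    also have "\<dots> \<le> norm f * K" using elim by (intro mult_left_mono) auto
    finally show ?case by (simp add: mult_ac)
  qed
  then have b: "fbounded \<Phi> (?g f)" for f by (rule fboundedI)
  have sub: "sublinear (\<lambda>f. flimsup \<Phi> (?g f))"
    by (rule sublinear_flimsup[OF \<Phi> b])
      (simp_all add: blinfun.add_left blinfun.scaleR_left re.add re.scaleR)
  obtain u where u: "linear u" "\<And>f. u f \<le> flimsup \<Phi> (?g f)"
    "u (Blinfun f0) = flimsup \<Phi> (?g (Blinfun f0))"
    using hahn_banach[OF sub] by blast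
  have "flimsup \<Phi> (?g f) \<le> 2 * K * norm f" for f
    by (rule flimsup_le[OF \<Phi> b]) (use le[of f] in \<open>auto elim: eventually_mono\<close>)
  then have "bounded_linear u" by (rule bounded_linear_below_sublinear[OF u(1,2)])
  from ex_bidual_real_part[OF this] obtain F where F: "F \<in> bidual smul"
    "\<And>f. f \<in> dual smul \<Longrightarrow> real_part (F f) = u (Blinfun f)" by blast
  have re_lim: "real_part (F f) = real_part l"
    if f: "f \<in> dual smul" and l: "((\<lambda>i. f (x i)) \<longlongrightarrow> l) \<Phi>" for f l
  proof -
    have *: "(?g (Blinfun f) \<longlongrightarrow> real_part l) \<Phi>" using re.tendsto[OF l] f by simp
    from tendsto_minus[OF this] have "(?g (- Blinfun f) \<longlongrightarrow> - real_part l) \<Phi>"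
      by (simp add: blinfun.minus_left re.neg)
    with * have "u (Blinfun f) \<le> real_part l" "u (- Blinfun f) \<le> - real_part l"
      using u(2) flimsup_eq_lim[OF \<Phi>] by metis+
    with F(2)[OF f] linear_neg[OF u(1)] show ?thesis by simp
  qed
  have "F f = l" if f: "f \<in> dual smul" and l: "((\<lambda>i. f (x i)) \<longlongrightarrow> l) \<Phi>" for f l
  proof -
    \<comment> \<open>Multiplying the functional by \<open>imag_unit\<close> recovers the other
      component of \<open>F f\<close>.\<close>
    have "real_part (imag_unit * F f) = real_part (imag_unit * l)"
      using re_lim[OF dual_scale[OF f], of imag_unit "imag_unit * l"] tendsto_mult_left[OF l]
      by (simp add: bidual_scale[OF F(1) f])
    with re_lim[OF f l] show ?thesis by (metis scalar_eq_real_parts)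
  qed
  then have "limit_functional \<Phi> x F" using F(1) by (simp add: limit_functional_def)
  moreover have "real_part (F f0) = flimsup \<Phi> (\<lambda>i. real_part (f0 (x i)))"
    using F(2)[OF f0] u(3) f0 by simp
  ultimately show thesis by (rule that)
qed

end

subsection \<open>Factorization of the dual\<close>

context banach_algebra
begin

text \<open>A factor obtained from Cohen's theorem is only real-linear. Over the complex numbers the
  denominator is \<open>2\<close> and this is the usual projection to the complex-linear part; over
  the reals \<open>g = y\<close>.\<close>

lemma smul_linear_part:
  assumes y: "bounded_linear y"
  defines "g \<equiv> \<lambda>b. (y b - imag_unit * y (smul imag_unit b)) / (1 - imag_unit * imag_unit)"
  shows "g \<in> dual smul"
proof (rule dualI)
  interpret y: bounded_linear y by fact
  have "bounded_linear (\<lambda>b. (1 / (1 - imag_unit * imag_unit)) * (y b - imag_unit * y (smul imag_unit b)))"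
    by (intro bounded_linear_compose[OF bounded_linear_mult_right] bounded_linear_sub y
        bounded_linear_compose[OF y] bounded_linear_smul)
  then show g: "bounded_linear g" by (simp add: g_def)
  interpret g: bounded_linear g by fact
  have i: "g (smul imag_unit b) = imag_unit * g b" for b
    using imag_unit_cases[where 'k = 'k]
  proof
    assume i: "imag_unit * imag_unit = (-1 :: 'k)"
    have "smul (-1) b = - b" using smul_of_real[of "-1" b] by simp
    then have "2 * g (smul imag_unit b) = y (smul imag_unit b) + imag_unit * y b"
      by (simp add: g_def i y.neg)
    also have "\<dots> = imag_unit * y b - (imag_unit * imag_unit) * y (smul imag_unit b)"
      by (simp add: i)
    also have "\<dots> = imag_unit * (y b - imag_unit * y (smul imag_unit b))"
      by (simp only: right_diff_distrib mult.assoc)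
    also have "y b - imag_unit * y (smul imag_unit b) = 2 * g b" by (simp add: g_def i)
    finally show ?thesis by (simp add: mult.left_commute)
  qed (simp add: g.zero)
  fix c :: 'k and b
  obtain r t where c: "c = of_real r + of_real t * imag_unit" using scalar_decomp by metis
  have "smul c b = r *\<^sub>R b + t *\<^sub>R smul imag_unit b"
    by (simp add: c scale_left_distrib smul_of_real flip: scale_scale)
  then show "g (smul c b) = c * g b"
    by (simp add: g.add g.scaleR i c scaleR_conv_of_real algebra_simps)
qed

text \<open>Taking for \<open>op\<close> the opposite multiplication gives the other side.\<close>

lemma dual_factorization:
  fixes op :: "'a \<Rightarrow> 'a \<Rightarrow> 'a"
  assumes op: "bounded_bilinear op"
    and assoc: "\<And>a b c. op (op a b) c = op a (op b c)"
    and smul1: "\<And>c a b. op (smul c a) b = smul c (op a b)"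
    and smul2: "\<And>c a b. op a (smul c b) = smul c (op a b)"
    and \<Phi>: "\<Phi> \<noteq> bot" and K: "\<forall>\<^sub>F i in \<Phi>. norm (e i) \<le> K"
    and approx: "\<And>a. ((\<lambda>i. op a (e i)) \<longlongrightarrow> a) \<Phi>"
    and f: "f \<in> dual smul"
    and vanish: "\<And>F. F \<in> bidual smul \<Longrightarrow> (\<And>a. F (\<lambda>b. f (op a b)) = 0) \<Longrightarrow> F f = 0"
  shows "\<exists>g\<in>dual smul. \<exists>a. f = (\<lambda>b. g (op a b))"
proof -
  interpret op: bounded_bilinear op by fact
  \<comment> \<open>The module action of the algebra on bounded real-linear maps, to which Cohen's
    theorem will be applied.\<close>
  define act :: "('a \<Rightarrow>\<^sub>L 'k) \<Rightarrow> 'a \<Rightarrow> 'a \<Rightarrow>\<^sub>L 'k" where "act = (\<lambda>g a. g o\<^sub>L op.prod_right a)"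
  have act_apply: "act g a b = g (op a b)" for g a b
    by (simp add: act_def op.prod_right.rep_eq)
  have "bounded_bilinear act"
    unfolding act_def
    by (rule bounded_bilinear.comp[OF bounded_bilinear_blinfun_compose bounded_linear_ident
          op.bounded_linear_prod_right])
  then interpret act: bounded_bilinear act .
  interpret approximately_unital_action act op \<Phi> e K
    by unfold_locales (auto intro!: blinfun_eqI \<Phi> K approx simp: act_apply assoc)
  have op_f: "(\<lambda>b. f (op a b)) \<in> dual smul" for a
    by (rule dualI) (auto simp: smul2 dual_smul[OF f]
        intro: bounded_linear_compose[OF dual_bounded_linear[OF f] op.bounded_linear_right])
  have Blinfun_op: "Blinfun (\<lambda>b. f (op a b)) = act (Blinfun f) a" for a
    by (rule blinfun_eqI) (simp add: act_apply op_f f)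
  obtain C where C: "C > 0" "\<And>g a. norm (act g a) \<le> norm g * norm a * C"
    using act.pos_bounded by blast
  \<comment> \<open>Otherwise a separating functional is nonzero at \<open>f\<close> but vanishes at
    every \<open>act (Blinfun f) a\<close>, since these are limits under the net; its scalar
    extension contradicts \<open>vanish\<close>.\<close>
  have "((\<lambda>i. act (Blinfun f) (e i)) \<longlongrightarrow> Blinfun f) \<Phi>"
  proof (rule ccontr)
    assume contr: "\<not> ?thesis"
    have lin: "linear (\<lambda>g. act g (e i))" for i
      by (rule bounded_linear.linear[OF act.bounded_linear_left])
    have le: "\<forall>\<^sub>F i in \<Phi>. \<forall>g. norm (act g (e i)) \<le> K * C * norm g"
      using K
    proof eventually_elim
      case (elim i)
      show ?case
      proof
        fix g
        have "norm (act g (e i)) \<le> norm g * norm (e i) * C" by (rule C(2))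
        also have "\<dots> \<le> norm g * K * C"
          using elim C(1) by (intro mult_right_mono mult_left_mono) auto
        finally show "norm (act g (e i)) \<le> K * C * norm g" by (simp add: mult_ac)
      qed
    qed
    obtain u :: "('a \<Rightarrow>\<^sub>L 'k) \<Rightarrow> real" where u: "bounded_linear u" "u (Blinfun f) \<noteq> 0"
      "\<And>g. ((\<lambda>i. act g (e i)) \<longlongrightarrow> g) \<Phi> \<Longrightarrow> u g = 0"
      using bounded_linear_separating_limits[OF \<Phi> lin le contr] by blast
    obtain F where F: "F \<in> bidual smul"
      and re: "\<And>g. g \<in> dual smul \<Longrightarrow> real_part (F g) = u (Blinfun g)"
      using ex_bidual_real_part[OF u(1)] by blast
    have 0: "real_part (F (\<lambda>b. f (op a b))) = 0" for a
    proof -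
      have "((\<lambda>i. act (act (Blinfun f) a) (e i)) \<longlongrightarrow> act (Blinfun f) a) \<Phi>"
        unfolding act_act by (intro act.tendsto tendsto_const approx)
      with u(3) show ?thesis by (simp add: re[OF op_f] Blinfun_op)
    qed
    \<comment> \<open>Replacing \<open>a\<close> by \<open>smul imag_unit a\<close> annihilates the
      other component as well.\<close>
    have "F (\<lambda>b. f (op a b)) = 0" for a
    proof -
      have "(\<lambda>b. f (op (smul imag_unit a) b)) = (\<lambda>b. imag_unit * f (op a b))"
        by (simp add: smul1 dual_smul[OF f])
      then have "real_part (imag_unit * F (\<lambda>b. f (op a b))) = 0"
        using 0[of "smul imag_unit a"] by (simp add: bidual_scale[OF F op_f])
      with 0[of a] show ?thesis
        by (subst scalar_eq_real_parts[of "F (\<lambda>b. f (op a b))"]) simp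
    qed
    then have "F f = of_real 0" by (simp add: vanish[OF F])
    with re[OF f] u(2) show False by (simp del: of_real_0)
  qed
  from cohen_factorization[OF this] obtain y a where "Blinfun f = act y a" by blast
  then have fy: "f b = y (op a b)" for b
    using f by (metis Blinfun_apply act_apply)
  let ?g = "\<lambda>b. (y b - imag_unit * y (smul imag_unit b)) / (1 - imag_unit * imag_unit)"
  have nz: "1 - imag_unit * imag_unit \<noteq> (0 :: 'k)"
    using imag_unit_cases[where 'k = 'k] by auto
  \<comment> \<open>Passing to the scalar-linear part of \<open>y\<close> preserves the
    factorization because \<open>f\<close> is itself scalar-linear.\<close>
  have "f b = ?g (op a b)" for b
  proof -
    have "y (op a b) - imag_unit * y (smul imag_unit (op a b)) = f b * (1 - imag_unit * imag_unit)"
      by (simp add: algebra_simps dual_smul[OF f] flip: fy smul2)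
    with nz show ?thesis by simp
  qed
  then show ?thesis
    by (intro bexI[OF _ smul_linear_part[OF blinfun.bounded_linear_right[of y]]] exI[of _ a]) auto
qed

end

section \<open>Weak convergence and the setting of an approximate identity\<close>

definition weakly_tendsto :: "(nat \<Rightarrow> 'v::real_normed_vector) \<Rightarrow> 'v \<Rightarrow> bool"
  where "weakly_tendsto x p \<longleftrightarrow>
    (\<forall>u :: 'v \<Rightarrow> real. bounded_linear u \<longrightarrow> (\<lambda>n. u (x n)) \<longlonglongrightarrow> u p)"

lemma weakly_tendstoI:
  "(\<And>u :: 'v \<Rightarrow> real. bounded_linear u \<Longrightarrow> (\<lambda>n. u (x n)) \<longlonglongrightarrow> u p) \<Longrightarrow> weakly_tendsto x p"
  for x :: "nat \<Rightarrow> 'v::real_normed_vector"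
  by (simp add: weakly_tendsto_def)

lemma weakly_tendstoD:
  "weakly_tendsto x p \<Longrightarrow> bounded_linear u \<Longrightarrow> (\<lambda>n. u (x n)) \<longlonglongrightarrow> u p"
  for u :: "'v::real_normed_vector \<Rightarrow> real"
  by (simp add: weakly_tendsto_def)

text \<open>The net enters as a nontrivial filter with an eventual norm bound; its index set and
  order are treated only at the end.\<close>

locale arens_regular_bai = banach_algebra smul
  for smul :: "'k::real_or_complex \<Rightarrow> 'a::{real_normed_algebra,banach} \<Rightarrow> 'a" +
  fixes \<Phi> :: "'i filter" and e :: "'i \<Rightarrow> 'a" and K :: real
  assumes regular: "arens_regular smul"
    and nontrivial: "\<Phi> \<noteq> bot"
    and bounded: "\<forall>\<^sub>F i in \<Phi>. norm (e i) \<le> K"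
    and right_approx: "((\<lambda>i. a * e i) \<longlongrightarrow> a) \<Phi>"
    and left_approx: "((\<lambda>i. e i * a) \<longlongrightarrow> a) \<Phi>"
begin

section \<open>The unit of the bidual and the factorization on both sides\<close>

lemma regularD:
  assumes "F \<in> bidual smul" "G \<in> bidual smul" "f \<in> dual smul"
  shows "F (bidual_act1 G f) = G (bidual_act2 f F)"
proof -
  have "arens1 smul F G f = arens2 smul F G f"
    using regular assms by (simp add: arens_regular_def)
  with assms(3) show ?thesis by (simp add: arens1_def arens2_def)
qed

lemma zero_in_dual: "(\<lambda>_. 0) \<in> dual smul"
  by (rule dualI) (auto intro: bounded_linear_zero)

lemma bidual_zero: "F \<in> bidual smul \<Longrightarrow> F (\<lambda>_. 0) = 0"
  using bidual_scale[OF _ zero_in_dual, of F 0] by simp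

text \<open>\<open>E\<close> is a generalized limit along the net: \<open>E.f\<close> at
  \<open>a\<close> is the limit of \<open>f (a * e i)\<close>, and \<open>f \<circ> E\<close> at
  \<open>a\<close> that of \<open>f (e i * a)\<close>.\<close>

lemma mixed_unit:
  obtains E where "E \<in> bidual smul"
    and "\<And>f. f \<in> dual smul \<Longrightarrow> bidual_act1 E f = f"
    and "\<And>f. f \<in> dual smul \<Longrightarrow> bidual_act2 f E = f"
proof -
  obtain E where E: "limit_functional \<Phi> e E"
    using ex_limit_functional[OF nontrivial bounded zero_in_dual] by blast
  have "bidual_act1 E f = f" "bidual_act2 f E = f" if f: "f \<in> dual smul" for f
  proof -
    note lim = bounded_linear.tendsto[OF dual_bounded_linear[OF f]]
    have "E (dual_act1 f a) = f a" for a
      by (rule limit_functional_eq[OF E dual_act1_in_dual[OF f]])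
        (simp add: dual_act1_def lim right_approx)
    moreover have "E (dual_act2 a f) = f a" for a
      by (rule limit_functional_eq[OF E dual_act2_in_dual[OF f]])
        (simp add: dual_act2_def lim left_approx)
    ultimately show "bidual_act1 E f = f" "bidual_act2 f E = f"
      by (simp_all add: bidual_act1_def bidual_act2_def)
  qed
  with limit_functional_bidual[OF E] show thesis by (rule that)
qed

lemma has_unit_bidual: "has_unit (bidual smul) (arens1 smul)"
proof -
  obtain E where E: "E \<in> bidual smul"
    "\<And>f. f \<in> dual smul \<Longrightarrow> bidual_act1 E f = f"
    "\<And>f. f \<in> dual smul \<Longrightarrow> bidual_act2 f E = f"
    using mixed_unit by blast
  have "arens1 smul E F = F \<and> arens1 smul F E = F" if F: "F \<in> bidual smul" for F
  proof -
    have "F \<in> extensional (dual smul)" using F by (simp add: bidual_def)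
    then show ?thesis
      using regularD[OF E(1) F] E(2,3)
      by (auto simp: arens1_def intro!: bidual_ext)
  qed
  with E(1) show ?thesis unfolding has_unit_def by blast
qed

lemma factors: "factors_on_both_sides smul"
proof -
  obtain E where E: "E \<in> bidual smul"
    "\<And>f. f \<in> dual smul \<Longrightarrow> bidual_act1 E f = f"
    "\<And>f. f \<in> dual smul \<Longrightarrow> bidual_act2 f E = f"
    using mixed_unit by blast
  have "\<exists>g\<in>dual smul. \<exists>a. f = (\<lambda>b. g (a * b))" if f: "f \<in> dual smul" for f
  proof (rule dual_factorization[OF bounded_bilinear_mult mult.assoc smul_mult_left smul_mult_right
        nontrivial bounded right_approx f])
    fix F
    assume F: "F \<in> bidual smul" "\<And>a. F (\<lambda>b. f (a * b)) = 0"
    \<comment> \<open>Regularity then gives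
      \<open>0 = E (F.f) = F (f \<circ> E) = F f\<close>.\<close>
    then have "bidual_act1 F f = (\<lambda>_. 0)" by (simp add: bidual_act1_def dual_act1_def)
    with regularD[OF E(1) F(1) f] show "F f = 0" by (simp add: E f bidual_zero)
  qed
  moreover have "\<exists>g\<in>dual smul. \<exists>a. f = (\<lambda>b. g (b * a))" if f: "f \<in> dual smul" for f
  proof (rule dual_factorization[where op = "\<lambda>a b. b * a",
        OF bounded_bilinear.flip[OF bounded_bilinear_mult] _ smul_mult_right smul_mult_left
        nontrivial bounded left_approx f])
    fix F
    assume F: "F \<in> bidual smul" "\<And>a. F (\<lambda>b. f (b * a)) = 0"
    \<comment> \<open>On this side regularity reads
      \<open>F f = F (E.f) = E (f \<circ> F) = 0\<close>.\<close>
    then have "bidual_act2 f F = (\<lambda>_. 0)" by (simp add: bidual_act2_def dual_act2_def)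
    with regularD[OF F(1) E(1) f] show "F f = 0" by (simp add: E f bidual_zero)
  qed (simp add: mult.assoc)
  ultimately show ?thesis
    using dual_act1_in_dual dual_act2_in_dual
    unfolding factors_on_both_sides_def dual_act1_def dual_act2_def by blast
qed

subsection \<open>The unit of a weakly sequentially complete algebra\<close>

lemma weakly_Cauchy:
  fixes x :: "nat \<Rightarrow> 'a"
  assumes M: "\<And>n. norm (x n) \<le> M"
    and r: "\<And>m. (\<lambda>n. x m * x n) \<longlonglongrightarrow> x m" and l: "\<And>m. (\<lambda>n. x n * x m) \<longlonglongrightarrow> x m"
    and f: "f \<in> dual smul"
  shows "Cauchy (\<lambda>n. f (x n))"
proof -
  note x = sequentially_bot always_eventually[OF allI[of "\<lambda>n. norm (x n) \<le> M", OF M]]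
  interpret re: bounded_linear "real_part :: 'k \<Rightarrow> real" by (rule bounded_linear_real_part)
  have re_conv: "convergent (\<lambda>n. real_part (f (x n)))" if f: "f \<in> dual smul" for f
  proof -
    let ?g = "\<lambda>n. real_part (f (x n))"
    \<comment> \<open>At \<open>f\<close>, the real part of \<open>F\<close> is the upper limit of
      \<open>?g\<close>, and that of \<open>G\<close>, chosen to be extremal at \<open>- f\<close>,
      is the lower limit. Showing \<open>F f = G f\<close> makes the two limits coincide.\<close>
    obtain F where F: "limit_functional sequentially x F" "real_part (F f) = flimsup sequentially ?g"
      using ex_limit_functional[OF x f] by blast
    obtain G where G: "limit_functional sequentially x G"
      "real_part (G (\<lambda>a. -1 * f a)) = flimsup sequentially (\<lambda>n. real_part (-1 * f (x n)))"
      using ex_limit_functional[OF x dual_scale[OF f]] by blast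
    note bidual = limit_functional_bidual[OF F(1)] limit_functional_bidual[OF G(1)]
    \<comment> \<open>A generalized limit depends only on values along \<open>x\<close>, since the
      difference \<open>g - f\<close> converges to \<open>0\<close> there.\<close>
    have agree: "H g = H f"
      if H: "limit_functional sequentially x H" and g: "g \<in> dual smul" "\<And>n. g (x n) = f (x n)"
      for H g
    proof -
      have "H (\<lambda>a. g a + -1 * f a) = 0"
        by (rule limit_functional_eq[OF H dual_sum[OF g(1) dual_scale[OF f]]]) (simp add: g(2))
      moreover have "H (\<lambda>a. g a + -1 * f a) = H g + -1 * H f"
        using bidual_add[OF limit_functional_bidual[OF H] g(1) dual_scale[OF f, of "-1"]]
          bidual_scale[OF limit_functional_bidual[OF H] f, of "-1"] by (simp only:)
      ultimately show ?thesis by simp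
    qed
    note lim = bounded_linear.tendsto[OF dual_bounded_linear[OF f]]
    \<comment> \<open>Since \<open>x m * x n\<close> tends to \<open>x m\<close>, the functional
      \<open>G.f\<close> agrees with \<open>f\<close> along \<open>x\<close>; the other order of
      factors does the same for \<open>f \<circ> F\<close>.\<close>
    have "bidual_act1 G f (x m) = f (x m)" for m
      unfolding bidual_act1_def
      by (rule limit_functional_eq[OF G(1) dual_act1_in_dual[OF f]]) (simp add: dual_act1_def lim r)
    then have "F (bidual_act1 G f) = F f"
      by (rule agree[OF F(1) bidual_act1_in_dual[OF bidual(2) f]])
    moreover have "bidual_act2 f F (x m) = f (x m)" for m
      unfolding bidual_act2_def
      by (rule limit_functional_eq[OF F(1) dual_act2_in_dual[OF f]]) (simp add: dual_act2_def lim l)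
    then have "G (bidual_act2 f F) = G f"
      by (rule agree[OF G(1) bidual_act2_in_dual[OF bidual(1) f]])
    ultimately have FG: "F f = G f" using regularD[OF bidual f] by simp
    have "real_part (G (\<lambda>a. -1 * f a)) = - real_part (G f)"
      unfolding bidual_scale[OF bidual(2) f] by (simp add: re.neg)
    with F(2) G(2) FG have "flimsup sequentially ?g + flimsup sequentially (\<lambda>n. - ?g n) \<le> 0"
      by (simp add: re.neg)
    moreover have "fbounded sequentially ?g"
    proof (rule fboundedI[OF always_eventually], rule allI)
      fix n
      have "norm (f (x n)) \<le> onorm f * norm (x n)" by (rule onorm[OF dual_bounded_linear[OF f]])
      also have "\<dots> \<le> onorm f * M"
        by (intro mult_left_mono M onorm_pos_le dual_bounded_linear f)
      finally show "\<bar>?g n\<bar> \<le> onorm f * M * 2"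
        using abs_real_part_le[of "f (x n)"] by linarith
    qed
    ultimately show ?thesis
      by (intro convergentI[OF tendsto_if_flimsup_minus[OF sequentially_bot]])
  qed
  obtain s t where "(\<lambda>n. real_part (f (x n))) \<longlonglongrightarrow> s" "(\<lambda>n. real_part (imag_unit * f (x n))) \<longlonglongrightarrow> t"
    using re_conv[OF f] re_conv[OF dual_scale[OF f]] unfolding convergent_def by blast
  then have "(\<lambda>n. of_real (real_part (f (x n))) - imag_unit * of_real (real_part (imag_unit * f (x n))))
      \<longlonglongrightarrow> (of_real s :: 'k) - imag_unit * of_real t"
    by (intro tendsto_intros)
  then show ?thesis
    unfolding scalar_eq_real_parts[symmetric] by (rule LIMSEQ_imp_Cauchy)
qed

lemma weak_limit:
  fixes x :: "nat \<Rightarrow> 'a"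
  assumes wsc: "weakly_sequentially_complete smul"
    and M: "\<And>n. norm (x n) \<le> M"
    and x: "\<And>m. (\<lambda>n. x m * x n) \<longlonglongrightarrow> x m" "\<And>m. (\<lambda>n. x n * x m) \<longlonglongrightarrow> x m"
  shows "\<exists>p. norm p \<le> M \<and>
    weakly_tendsto x p \<and>
    (\<forall>a. (\<lambda>n. a * x n) \<longlonglongrightarrow> a \<longrightarrow> a * p = a) \<and>
    (\<forall>a. (\<lambda>n. x n * a) \<longlonglongrightarrow> a \<longrightarrow> p * a = a)"
proof -
  have "\<forall>f\<in>dual smul. Cauchy (\<lambda>n. f (x n))" using weakly_Cauchy[OF M x] by blast
  then obtain p where p: "\<And>f. f \<in> dual smul \<Longrightarrow> (\<lambda>n. f (x n)) \<longlonglongrightarrow> f p"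
    using wsc unfolding weakly_sequentially_complete_def by blast
  have lim: "(\<lambda>n. u (x n)) \<longlonglongrightarrow> u p" if u: "bounded_linear u" for u :: "'a \<Rightarrow> real"
  proof -
    obtain f where f: "f \<in> dual smul" "\<And>a. real_part (f a) = u a"
      using ex_dual_real_part[OF u] by blast
    from bounded_linear.tendsto[OF bounded_linear_real_part p[OF f(1)]] show ?thesis
      by (simp add: f(2))
  qed
  \<comment> \<open>A bounded linear \<open>T\<close> preserves weak limits, so a norm limit of
    \<open>T (x n)\<close> must be \<open>T p\<close>. Multiplications by a fixed element are the
    instances used.\<close>
  have eq: "T p = a" if T: "bounded_linear T" and a: "(\<lambda>n. T (x n)) \<longlonglongrightarrow> a" for T :: "'a \<Rightarrow> 'a" and a
  proof (rule eq_if_bounded_linear_eq)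
    fix u :: "'a \<Rightarrow> real"
    assume u: "bounded_linear u"
    show "u (T p) = u a"
      using lim[OF bounded_linear_compose[OF u T]] bounded_linear.tendsto[OF u a]
      by (rule LIMSEQ_unique)
  qed
  obtain u :: "'a \<Rightarrow> real" where u: "bounded_linear u" "\<And>x. u x \<le> norm x" "u p = norm p"
    using bounded_linear_norming by blast
  have "norm p \<le> M"
    using LIMSEQ_le_const2[OF lim[OF u(1)], of M] order_trans[OF u(2) M] u(3) by auto
  then show ?thesis
    by (intro exI[of _ p] conjI allI impI weakly_tendstoI lim eq[OF bounded_linear_mult_right]
        eq[OF bounded_linear_mult_left])
qed

text \<open>Each new term is a member of the net that acts as a unit up to
  \<open>(1 / 2) ^ n\<close> on a finite set containing \<open>S\<close> and all terms chosen so
  far.\<close>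

lemma approximating_sequence:
  assumes S: "finite S"
  obtains x :: "nat \<Rightarrow> 'a" where "\<And>n. norm (x n) \<le> K"
    and "\<And>m. (\<lambda>n. x m * x n) \<longlonglongrightarrow> x m" "\<And>m. (\<lambda>n. x n * x m) \<longlonglongrightarrow> x m"
    and "\<And>a. a \<in> S \<Longrightarrow> (\<lambda>n. a * x n) \<longlonglongrightarrow> a" "\<And>a. a \<in> S \<Longrightarrow> (\<lambda>n. x n * a) \<longlonglongrightarrow> a"
proof -
  have K: "K \<ge> 0"
    using eventually_happens'[OF nontrivial bounded] by (meson norm_ge_zero order_trans)
  define P where "P = (\<lambda>(n::nat) (T, y). finite T \<and> S \<subseteq> T \<and> y \<in> T \<and> norm (y :: 'a) \<le> K)"
  define Q where "Q = (\<lambda>(n::nat) (T, y :: 'a) (T', y'). T \<subseteq> T' \<and>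
    (\<forall>a\<in>T. norm (a * y' - a) \<le> (1 / 2 :: real) ^ n \<and> norm (y' * a - a :: 'a) \<le> (1 / 2) ^ n))"
  have "\<exists>s. \<forall>n. P n (s n) \<and> Q n (s n) (s (Suc n))"
  proof (rule dependent_nat_choice)
    \<comment> \<open>The sequence starts with the element \<open>0\<close>; the approximation
      begins with the next term, hence the index shift below.\<close>
    show "\<exists>q. P 0 q"
      using S K by (intro exI[of _ "(insert 0 S, 0)"]) (auto simp: P_def)
  next
    fix q n
    assume "P n q"
    moreover obtain T y where q: "q = (T, y)" by (cases q)
    ultimately have T: "finite T" "S \<subseteq> T" by (auto simp: P_def)
    have "\<forall>\<^sub>F i in \<Phi>. dist (a * e i) a < (1 / 2) ^ n \<and> dist (e i * a) a < (1 / 2) ^ n" for a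
      using right_approx left_approx by (intro eventually_conj tendstoD) auto
    then have "\<forall>\<^sub>F i in \<Phi>. \<forall>a\<in>T. dist (a * e i) a < (1 / 2) ^ n \<and> dist (e i * a) a < (1 / 2) ^ n"
      using T(1) by (simp add: eventually_ball_finite)
    from eventually_happens'[OF nontrivial eventually_conj[OF bounded this]]
    obtain i where "norm (e i) \<le> K"
      "\<forall>a\<in>T. dist (a * e i) a < (1 / 2) ^ n \<and> dist (e i * a) a < (1 / 2) ^ n" by blast
    with T show "\<exists>q'. P (Suc n) q' \<and> Q n q q'"
      by (intro exI[of _ "(insert (e i) T, e i)"]) (auto simp: P_def Q_def q dist_norm less_imp_le)
  qed
  then obtain s where s: "\<And>n. P n (s n)" "\<And>n. Q n (s n) (s (Suc n))" by blast
  define T x where "T = (\<lambda>n. fst (s n))" and "x = (\<lambda>n. snd (s n))"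
  have T: "S \<subseteq> T n" "x n \<in> T n" "norm (x n) \<le> K" for n
    using s(1)[of n] by (auto simp: P_def T_def x_def split: prod.splits)
  have step: "T n \<subseteq> T (Suc n)" "a \<in> T n \<Longrightarrow> norm (a * x (Suc n) - a) \<le> (1 / 2) ^ n"
    "a \<in> T n \<Longrightarrow> norm (x (Suc n) * a - a) \<le> (1 / 2) ^ n" for n a
    using s(2)[of n] by (auto simp: Q_def T_def x_def split: prod.splits)
  have half: "(\<lambda>n. (1 / 2 :: real) ^ n) \<longlonglongrightarrow> 0" by (rule LIMSEQ_power_zero) simp
  have lim: "(\<lambda>n. a * x n) \<longlonglongrightarrow> a" "(\<lambda>n. x n * a) \<longlonglongrightarrow> a" if a: "a \<in> T m" for a m
  proof -
    have "a \<in> T n" if "n \<ge> m" for n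
      using lift_Suc_mono_le[of T, OF step(1) that] a by blast
    then have "\<forall>\<^sub>F n in sequentially. a \<in> T n" by (auto simp: eventually_sequentially)
    then have "\<forall>\<^sub>F n in sequentially. norm (a * x (Suc n) - a) \<le> (1 / 2) ^ n"
      "\<forall>\<^sub>F n in sequentially. norm (x (Suc n) * a - a) \<le> (1 / 2) ^ n"
      by (auto elim!: eventually_mono intro: step)
    then have "(\<lambda>n. a * x (Suc n) - a) \<longlonglongrightarrow> 0" "(\<lambda>n. x (Suc n) * a - a) \<longlonglongrightarrow> 0"
      using half by (auto intro: Lim_null_comparison)
    then have "(\<lambda>n. a * x (Suc n)) \<longlonglongrightarrow> a" "(\<lambda>n. x (Suc n) * a) \<longlonglongrightarrow> a"
      by (simp_all add: LIM_zero_iff)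
    then show "(\<lambda>n. a * x n) \<longlonglongrightarrow> a" "(\<lambda>n. x n * a) \<longlonglongrightarrow> a"
      by (auto intro: LIMSEQ_imp_Suc)
  qed
  show thesis
    by (rule that[of x]) (use T lim in blast)+
qed

text \<open>Take \<open>a\<close> on which \<open>p\<close> fails to act as a unit. The weak limit
  of an approximating sequence for \<open>{p, a}\<close> acts as a unit on both, so it differs from
  \<open>p\<close>.\<close>

lemma ex_larger_idempotent:
  fixes p :: 'a
  assumes wsc: "weakly_sequentially_complete smul"
    and non_unital: "\<not> has_unit (UNIV :: 'a set) (*)"
  shows "\<exists>q. norm q \<le> K \<and> q * q = q \<and> p * q = p \<and> q * p = p \<and> q \<noteq> p"
proof -
  obtain a where a: "\<not> (p * a = a \<and> a * p = a)"
    using non_unital unfolding has_unit_def by blast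
  obtain x :: "nat \<Rightarrow> 'a" where x: "\<And>n. norm (x n) \<le> K"
    "\<And>m. (\<lambda>n. x m * x n) \<longlonglongrightarrow> x m" "\<And>m. (\<lambda>n. x n * x m) \<longlonglongrightarrow> x m"
    and S: "\<And>b. b \<in> {p, a} \<Longrightarrow> (\<lambda>n. b * x n) \<longlonglongrightarrow> b" "\<And>b. b \<in> {p, a} \<Longrightarrow> (\<lambda>n. x n * b) \<longlonglongrightarrow> b"
    using approximating_sequence[of "{p, a}"] by auto
  obtain q where q: "norm q \<le> K"
    "weakly_tendsto x q"
    "\<And>a. (\<lambda>n. a * x n) \<longlonglongrightarrow> a \<Longrightarrow> a * q = a" "\<And>a. (\<lambda>n. x n * a) \<longlonglongrightarrow> a \<Longrightarrow> q * a = a"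
    using weak_limit[OF wsc x] by blast
  \<comment> \<open>Every \<open>x n * q\<close> equals \<open>x n\<close>, so \<open>q * q\<close>
    and \<open>q\<close> are weak limits of the same sequence.\<close>
  have "q * q = q"
  proof (rule eq_if_bounded_linear_eq)
    fix u :: "'a \<Rightarrow> real"
    assume u: "bounded_linear u"
    have "(\<lambda>n. u (x n * q)) \<longlonglongrightarrow> u (q * q)"
      by (rule weakly_tendstoD[OF q(2) bounded_linear_compose[OF u bounded_linear_mult_left]])
    with weakly_tendstoD[OF q(2) u] show "u (q * q) = u q"
      by (simp add: q(3)[OF x(2)] LIMSEQ_unique)
  qed
  moreover have "p * q = p" "q * p = p" "a * q = a" "q * a = a"
    using q(3,4) S by auto
  ultimately show ?thesis using q(1) a by metis
qed

lemma has_unit_if_wsc: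
  assumes wsc: "weakly_sequentially_complete smul"
  shows "has_unit (UNIV :: 'a set) (*)"
proof (rule ccontr)
  assume non_unital: "\<not> ?thesis"
  have K: "K \<ge> 0"
    using eventually_happens'[OF nontrivial bounded] by (meson norm_ge_zero order_trans)
  \<comment> \<open>Dependent choice starting from the idempotent \<open>0\<close>.\<close>
  have "\<exists>p :: nat \<Rightarrow> 'a. \<forall>n. (norm (p n) \<le> K \<and> p n * p n = p n) \<and>
      (p n * p (Suc n) = p n \<and> p (Suc n) * p n = p n \<and> p (Suc n) \<noteq> p n)"
    by (rule dependent_nat_choice)
      (use ex_larger_idempotent[OF wsc non_unital] K in \<open>auto intro: exI[of _ 0]\<close>)
  then obtain p :: "nat \<Rightarrow> 'a" where p: "\<And>n. norm (p n) \<le> K" "\<And>n. p n * p n = p n"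
    "\<And>n. p n * p (Suc n) = p n" "\<And>n. p (Suc n) * p n = p n" "\<And>n. p (Suc n) \<noteq> p n"
    by blast
  have le: "p m * p n = p m \<and> p n * p m = p m" if "m \<le> n" for m n
    using that
  proof (induction n rule: dec_induct)
    case (step n)
    have "p m * p (Suc n) = p m * (p n * p (Suc n))" by (metis mult.assoc step.IH)
    moreover have "p (Suc n) * p m = (p (Suc n) * p n) * p m" by (metis mult.assoc step.IH)
    ultimately show ?case using step.IH by (simp add: p)
  qed (simp add: p)
  have lim: "(\<lambda>n. p m * p n) \<longlonglongrightarrow> p m" "(\<lambda>n. p n * p m) \<longlonglongrightarrow> p m" for m
    by (rule tendsto_eventually; use le in \<open>auto simp: eventually_sequentially intro!: exI[of _ m]\<close>)+
  obtain q where q: "weakly_tendsto p q"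
    "\<And>a. (\<lambda>n. a * p n) \<longlonglongrightarrow> a \<Longrightarrow> a * q = a"
    using weak_limit[OF wsc p(1) lim] by blast
  \<comment> \<open>All \<open>p m\<close> satisfy
    \<open>p n * p m \<longlonglongrightarrow> p m\<close>. If \<open>q\<close> did not, a
    functional vanishing on all \<open>p m\<close> but not at \<open>q\<close> would contradict weak
    convergence.\<close>
  have "(\<lambda>n. p n * q) \<longlonglongrightarrow> q"
  proof (rule ccontr)
    assume contr: "\<not> ?thesis"
    have "norm (p n * z) \<le> K * norm z" for n z
      by (rule order_trans[OF norm_mult_ineq]) (simp add: mult_right_mono p(1))
    then have le: "\<forall>\<^sub>F n in sequentially. \<forall>z. norm (p n * z) \<le> K * norm z"
      by simp
    obtain u :: "'a \<Rightarrow> real" where u: "bounded_linear u" "u q \<noteq> 0"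
      "\<And>z. (\<lambda>n. p n * z) \<longlonglongrightarrow> z \<Longrightarrow> u z = 0"
      using bounded_linear_separating_limits[OF sequentially_bot
          bounded_linear.linear[OF bounded_linear_mult_right] le contr] by blast
    have "u (p n) = 0" for n by (rule u(3)[OF lim(2)])
    with weakly_tendstoD[OF q(1) u(1)] u(2) show False by (simp add: LIMSEQ_const_iff)
  qed
  \<comment> \<open>Here \<open>p n * q = p n\<close>, so the convergence just shown is norm
    convergence of \<open>p\<close> itself.\<close>
  then have "p \<longlonglongrightarrow> q" by (simp add: q(2)[OF lim(1)])
  from tendsto_norm[OF tendsto_diff[OF LIMSEQ_Suc[OF this] this]]
  have "(\<lambda>n. norm (p (Suc n) - p n)) \<longlonglongrightarrow> 0" by simp
  then obtain n where n: "norm (p (Suc n) - p n) < 1"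
    using eventually_happens'[OF sequentially_bot order_tendstoD(2)] zero_less_one by blast
  let ?r = "p (Suc n) - p n"
  \<comment> \<open>A nonzero idempotent has norm at least \<open>1\<close>, by
    submultiplicativity.\<close>
  have "?r * ?r = ?r" by (simp add: algebra_simps p)
  then have "norm ?r \<le> norm ?r * norm ?r" by (metis norm_mult_ineq)
  moreover have "norm ?r > 0" using p(5)[of n] by simp
  ultimately show False using n by simp
qed

end

section \<open>From nets to filters, and the conclusion\<close>

lemma eventually_tails:
  assumes "directed I le"
  shows "eventually P (tails I le) \<longleftrightarrow> (\<exists>i\<in>I. \<forall>j\<in>I. le i j \<longrightarrow> P j)"
  unfolding tails_def
proof (subst eventually_INF_base)
  show "I \<noteq> {}" using assms unfolding directed_def by blast
  fix i j
  assume ij: "i \<in> I" "j \<in> I"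
  then obtain k where k: "k \<in> I" "le i k" "le j k"
    using assms unfolding directed_def by blast
  \<comment> \<open>Directedness makes the tails a filter base: the tail of an upper bound lies in
    both tails.\<close>
  then have "{l\<in>I. le k l} \<subseteq> {l\<in>I. le i l} \<inter> {l\<in>I. le j l}"
    using assms ij unfolding directed_def by blast
  then show "\<exists>k\<in>I. principal {l\<in>I. le k l} \<le> inf (principal {l\<in>I. le i l}) (principal {l\<in>I. le j l})"
    using k(1) by (intro bexI[of _ k]) simp_all
qed (auto simp: eventually_principal)

theorem corollary6:
  fixes smul :: "'k::real_or_complex \<Rightarrow> 'a::{real_normed_algebra,banach} \<Rightarrow> 'a"
    and I :: "'i set" and le :: "'i \<Rightarrow> 'i \<Rightarrow> bool" and e :: "'i \<Rightarrow> 'a"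
  assumes "banach_algebra smul"
    and "arens_regular smul"
    and "bounded_approximate_identity I le e"
  shows "factors_on_both_sides smul \<and>
    has_unit (bidual smul) (arens1 smul) \<and>
    (weakly_sequentially_complete smul \<longrightarrow> has_unit (UNIV :: 'a set) (*))"
proof -
  interpret banach_algebra smul by fact
  have dir: "directed I le" and bdd: "bounded (e ` I)"
    and approx: "\<And>a. ((\<lambda>i. a * e i) \<longlongrightarrow> a) (tails I le)" "\<And>a. ((\<lambda>i. e i * a) \<longlongrightarrow> a) (tails I le)"
    using assms(3) by (auto simp: bounded_approximate_identity_def)
  obtain K where K: "\<And>i. i \<in> I \<Longrightarrow> norm (e i) \<le> K"
    using bdd by (auto simp: bounded_iff)
  \<comment> \<open>Each tail contains its own starting index, by reflexivity, so the filter is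
    nontrivial.\<close>
  have "\<not> (\<forall>\<^sub>F i in tails I le. False)"
    using dir unfolding eventually_tails[OF dir] directed_def by blast
  then have "tails I le \<noteq> bot" by (simp add: eventually_False)
  moreover have "\<forall>\<^sub>F i in tails I le. norm (e i) \<le> K"
    using dir K unfolding eventually_tails[OF dir] directed_def by blast
  ultimately interpret arens_regular_bai smul "tails I le" e K
    using assms(2) approx by unfold_locales
  show ?thesis using factors has_unit_bidual has_unit_if_wsc by blast
qed

end
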